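(* There exists a nontrivial, bounded endofunctor $F$ on $\mathbf{Set}$ that weakly preserves pullbacks such that $\mathbf{Pfn}_F$ is prodominical but not dominical.
   Context: An $F$-coalgebra is a set $A$ with a map $\alpha:A\to FA$; a morphism $(A,\alpha)\to(B,\beta)$ is a map $\varphi$ with $\beta\varphi=F(\varphi)\alpha$; these form $\mathbf{Set}_F$. A subcoalgebra of $A$ is a subset carrying a (necessarily unique) coalgebra structure making the inclusion a morphism. $F$ is nontrivial if $FX=\emptyset$ implies $X=\emptyset$; weakly preserves pullbacks if it sends pullback squares to squares having the pullback property except possibly uniqueness; bounded if there is a cardinal $\kappa$ such that every element of every coalgebra lies in a subcoalgebra of cardinality at most $\kappa$. Under these three conditions $\mathbf{Set}_F$ is complete and its monomorphisms are exactly the injective morphisms. $\mathbf{Pfn}_F$ is the category with the $F$-coalgebras as objects, in which a morphism $X\to Y$ is an equivalence class $\{m,\varphi\}$ of pairs with $m:U\to X$ a monomorphism and $\varphi:U\to Y$ a morphism of $\mathbf{Set}_F$, where $(m,\varphi)\sim(m',\varphi')$ if $m=m'\theta$ and $\varphi=\varphi'\theta$ for an isomorphism $\theta$. Composition is by pullback: $\{m',\varphi'\}\circ\{m,\varphi\}=\{mq,\varphi'r\}$, where $q,r$ are the projections of the pullback of $\varphi$ and $m'$ (with $q$ the pullback of $m'$). $\mathbf{Set}_F$ is embedded by $\varphi\mapsto\{1,\varphi\}$. The near product is $X\boxtimes Y=X\times Y$ (product in $\mathbf{Set}_F$), $\{m,\varphi\}\boxtimes\{m',\varphi'\}=\{m\times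 m',\varphi\times\varphi'\}$, with the diagonals $\Delta$ and projections $p_0,p_1$ of $\mathbf{Set}_F$. An infranatural transformation $\phi:G\to H$ of functors is a family of components $\phi_X:GX\to HX$; $\mathrm{nat}\,\phi$ is the largest subcategory, containing all objects, on which it is natural. A $P$-category is a category $\mathbf{C}$ with a functor $\boxtimes:\mathbf{C}^2\to\mathbf{C}$, a natural transformation $\Delta_X:X\to X\boxtimes X$, and infranatural transformations $p_i:\boxtimes\to\pi_i$ to the $i$-th projection functor ($i=0,1$) such that, with $\langle f,g\rangle=(f\boxtimes g)\Delta$: (i) $p_{i\,X,X}\Delta_X=1_X$ and $(p_{0\,X,X}\boxtimes p_{1\,X,X})\Delta_{X\boxtimes X}=1_{X\boxtimes X}$; (ii) if $\mathbf{P}$ is the smallest subcategory closed under $\boxtimes$ containing all components of $p_0,p_1$, then $\mathbf{C}\times\mathbf{P}\subseteq\mathrm{nat}\,p_0$ and $\mathbf{P}\times\mathbf{C}\subseteq\mathrm{nat}\,p_1$; (iii) $\langle p_0p_0,\langle p_1p_0,p_1\rangle\rangle:(X\boxtimes Y)\boxtimes Z\to X\boxtimes(Y\boxtimes Z)$ is a natural isomorphism; (iv) $\langle p_1,p_0\rangle:X\boxtimes Y\to Y\boxtimes X$ is a natural isomorphism; and these make $\boxtimes$ coherently associative and commutative (pentagon, hexagon, symmetry). The domain of $\phi:X\to Y$ is $\mathrm{dom}\,\phi=p_{0\,X,Y}\langle1_X,\phi\rangle:X\to X$; $\phi$ is total if $\mathrm{dom}\,\phi=1_X$. A system of zero morphisms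 is a family $0_{X,Y}:X\to Y$ with $g\,0_{X,Y}f=0_{W,Z}$ for all $f:W\to X$, $g:Y\to Z$ (unique if it exists; in $\mathbf{Pfn}_F$, $0_{A,B}=\{\emptyset\to A,\emptyset\to B\}$). A $P$-category is prodominical if it has a system of zero morphisms and $\phi\boxtimes0_{C,D}=0_{A\boxtimes C,B\boxtimes D}$ for every $\phi:A\to B$. A morphism $f:X\to Y$ is weakly total if for all $\phi:W\to X$, $f\phi=0_{W,Y}$ implies $\phi=0_{W,X}$. A prodominical category is dominical if every weakly total morphism is total and $\phi\boxtimes\psi=0$ implies $\phi=0$ or $\psi=0$. *)

theory Defs
  imports Main "HOL-Library.FuncSet" "HOL-Library.Equipollence"
begin

text \<open>Composition is written in the usual order: \<open>g \<cdot> f\<close> is \<open>g\<close> after \<open>f\<close>.\<close>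

record ('o, 'a) cat =
  Obj :: "'o set"
  Arr :: "'a set"
  Dom :: "'a \<Rightarrow> 'o"
  Cod :: "'a \<Rightarrow> 'o"
  Idn :: "'o \<Rightarrow> 'a"
  Comp :: "'a \<Rightarrow> 'a \<Rightarrow> 'a" (infixl "\<cdot>\<index>" 70)

definition hom :: "('o, 'a, 'x) cat_scheme \<Rightarrow> 'o \<Rightarrow> 'o \<Rightarrow> 'a set" where
  "hom C X Y = {f \<in> Arr C. Dom C f = X \<and> Cod C f = Y}"

definition category :: "('o, 'a, 'x) cat_scheme \<Rightarrow> bool" where
  "category C \<longleftrightarrow>
     (\<forall>f \<in> Arr C. Dom C f \<in> Obj C \<and> Cod C f \<in> Obj C) \<and>
     (\<forall>X \<in> Obj C. Idn C X \<in> hom C X X) \<and>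
     (\<forall>f \<in> Arr C. \<forall>g \<in> Arr C. Dom C g = Cod C f \<longrightarrow>
        g \<cdot>\<^bsub>C\<^esub> f \<in> hom C (Dom C f) (Cod C g)) \<and>
     (\<forall>f \<in> Arr C. f \<cdot>\<^bsub>C\<^esub> Idn C (Dom C f) = f \<and> Idn C (Cod C f) \<cdot>\<^bsub>C\<^esub> f = f) \<and>
     (\<forall>f \<in> Arr C. \<forall>g \<in> Arr C. \<forall>h \<in> Arr C. Dom C g = Cod C f \<longrightarrow> Dom C h = Cod C g \<longrightarrow>
        h \<cdot>\<^bsub>C\<^esub> (g \<cdot>\<^bsub>C\<^esub> f) = (h \<cdot>\<^bsub>C\<^esub> g) \<cdot>\<^bsub>C\<^esub> f)"

definition mono_arr :: "('o, 'a, 'x) cat_scheme \<Rightarrow> 'a \<Rightarrow> bool" where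
  "mono_arr C m \<longleftrightarrow> m \<in> Arr C \<and>
     (\<forall>f \<in> Arr C. \<forall>g \<in> Arr C. Dom C f = Dom C g \<longrightarrow> Cod C f = Dom C m \<longrightarrow> Cod C g = Dom C m \<longrightarrow>
        m \<cdot>\<^bsub>C\<^esub> f = m \<cdot>\<^bsub>C\<^esub> g \<longrightarrow> f = g)"

definition iso_arr :: "('o, 'a, 'x) cat_scheme \<Rightarrow> 'a \<Rightarrow> bool" where
  "iso_arr C f \<longleftrightarrow> f \<in> Arr C \<and>
     (\<exists>g \<in> hom C (Cod C f) (Dom C f).
        g \<cdot>\<^bsub>C\<^esub> f = Idn C (Dom C f) \<and> f \<cdot>\<^bsub>C\<^esub> g = Idn C (Cod C f))"

definition commuting_square :: "('o, 'a, 'x) cat_scheme \<Rightarrow> 'a \<Rightarrow> 'a \<Rightarrow> 'a \<Rightarrow> 'a \<Rightarrow> bool" where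
  "commuting_square C f g q r \<longleftrightarrow>
     f \<in> Arr C \<and> g \<in> Arr C \<and> q \<in> Arr C \<and> r \<in> Arr C \<and>
     Cod C f = Cod C g \<and> Dom C q = Dom C r \<and> Cod C q = Dom C f \<and> Cod C r = Dom C g \<and>
     f \<cdot>\<^bsub>C\<^esub> q = g \<cdot>\<^bsub>C\<^esub> r"

text \<open>In the next two definitions \<open>q\<close> and \<open>r\<close> are the projections to the domains of
  \<open>f\<close> and \<open>g\<close>.\<close>

definition pullback :: "('o, 'a, 'x) cat_scheme \<Rightarrow> 'a \<Rightarrow> 'a \<Rightarrow> 'a \<Rightarrow> 'a \<Rightarrow> bool" where
  "pullback C f g q r \<longleftrightarrow> commuting_square C f g q r \<and>
     (\<forall>q' r'. commuting_square C f g q' r' \<longrightarrow>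
        (\<exists>!h. h \<in> hom C (Dom C q') (Dom C q) \<and> q \<cdot>\<^bsub>C\<^esub> h = q' \<and> r \<cdot>\<^bsub>C\<^esub> h = r'))"

definition weak_pullback :: "('o, 'a, 'x) cat_scheme \<Rightarrow> 'a \<Rightarrow> 'a \<Rightarrow> 'a \<Rightarrow> 'a \<Rightarrow> bool" where
  "weak_pullback C f g q r \<longleftrightarrow> commuting_square C f g q r \<and>
     (\<forall>q' r'. commuting_square C f g q' r' \<longrightarrow>
        (\<exists>h. h \<in> hom C (Dom C q') (Dom C q) \<and> q \<cdot>\<^bsub>C\<^esub> h = q' \<and> r \<cdot>\<^bsub>C\<^esub> h = r'))"

definition product_cone :: "('o, 'a, 'x) cat_scheme \<Rightarrow> 'o \<Rightarrow> 'o \<Rightarrow> 'a \<Rightarrow> 'a \<Rightarrow> bool" where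
  "product_cone C X Y p q \<longleftrightarrow>
     p \<in> Arr C \<and> q \<in> Arr C \<and> Dom C p = Dom C q \<and> Cod C p = X \<and> Cod C q = Y \<and>
     (\<forall>W \<in> Obj C. \<forall>f \<in> hom C W X. \<forall>g \<in> hom C W Y.
        \<exists>!h. h \<in> hom C W (Dom C p) \<and> p \<cdot>\<^bsub>C\<^esub> h = f \<and> q \<cdot>\<^bsub>C\<^esub> h = g)"


section \<open>Functors, infranatural transformations, subcategories\<close>

record ('o, 'a, 'p, 'b) fctr =
  OMap :: "'o \<Rightarrow> 'p"
  AMap :: "'a \<Rightarrow> 'b"

definition is_functor ::
  "('o, 'a, 'x) cat_scheme \<Rightarrow> ('p, 'b, 'y) cat_scheme \<Rightarrow> ('o, 'a, 'p, 'b) fctr \<Rightarrow> bool" where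
  "is_functor C D F \<longleftrightarrow>
     (\<forall>X \<in> Obj C. OMap F X \<in> Obj D) \<and>
     (\<forall>f \<in> Arr C. AMap F f \<in> hom D (OMap F (Dom C f)) (OMap F (Cod C f))) \<and>
     (\<forall>X \<in> Obj C. AMap F (Idn C X) = Idn D (OMap F X)) \<and>
     (\<forall>f \<in> Arr C. \<forall>g \<in> Arr C. Dom C g = Cod C f \<longrightarrow>
        AMap F (g \<cdot>\<^bsub>C\<^esub> f) = AMap F g \<cdot>\<^bsub>D\<^esub> AMap F f)"

definition weakly_preserves_pullbacks ::
  "('o, 'a, 'x) cat_scheme \<Rightarrow> ('p, 'b, 'y) cat_scheme \<Rightarrow> ('o, 'a, 'p, 'b) fctr \<Rightarrow> bool" where
  "weakly_preserves_pullbacks C D F \<longleftrightarrow>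
     (\<forall>f g q r. pullback C f g q r \<longrightarrow>
        weak_pullback D (AMap F f) (AMap F g) (AMap F q) (AMap F r))"

definition prod_cat ::
  "('o, 'a, 'x) cat_scheme \<Rightarrow> ('p, 'b, 'y) cat_scheme \<Rightarrow> ('o \<times> 'p, 'a \<times> 'b) cat" where
  "prod_cat C D =
     \<lparr>Obj = Obj C \<times> Obj D, Arr = Arr C \<times> Arr D,
      Dom = map_prod (Dom C) (Dom D), Cod = map_prod (Cod C) (Cod D),
      Idn = map_prod (Idn C) (Idn D),
      Comp = (\<lambda>(g, g') (f, f'). (g \<cdot>\<^bsub>C\<^esub> f, g' \<cdot>\<^bsub>D\<^esub> f'))\<rparr>"

definition infranatural ::
  "('o, 'a, 'x) cat_scheme \<Rightarrow> ('p, 'b, 'y) cat_scheme \<Rightarrow> ('o, 'a, 'p, 'b) fctr \<Rightarrow>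
   ('o, 'a, 'p, 'b) fctr \<Rightarrow> ('o \<Rightarrow> 'b) \<Rightarrow> bool" where
  "infranatural C D G H \<eta> \<longleftrightarrow> (\<forall>X \<in> Obj C. \<eta> X \<in> hom D (OMap G X) (OMap H X))"

definition natural_on ::
  "('o, 'a, 'x) cat_scheme \<Rightarrow> ('p, 'b, 'y) cat_scheme \<Rightarrow> ('o, 'a, 'p, 'b) fctr \<Rightarrow>
   ('o, 'a, 'p, 'b) fctr \<Rightarrow> ('o \<Rightarrow> 'b) \<Rightarrow> 'a set \<Rightarrow> bool" where
  "natural_on C D G H \<eta> S \<longleftrightarrow>
     (\<forall>f \<in> S. \<eta> (Cod C f) \<cdot>\<^bsub>D\<^esub> AMap G f = AMap H f \<cdot>\<^bsub>D\<^esub> \<eta> (Dom C f))"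

definition natural ::
  "('o, 'a, 'x) cat_scheme \<Rightarrow> ('p, 'b, 'y) cat_scheme \<Rightarrow> ('o, 'a, 'p, 'b) fctr \<Rightarrow>
   ('o, 'a, 'p, 'b) fctr \<Rightarrow> ('o \<Rightarrow> 'b) \<Rightarrow> bool" where
  "natural C D G H \<eta> \<longleftrightarrow> infranatural C D G H \<eta> \<and> natural_on C D G H \<eta> (Arr C)"

definition natural_iso ::
  "('o, 'a, 'x) cat_scheme \<Rightarrow> ('p, 'b, 'y) cat_scheme \<Rightarrow> ('o, 'a, 'p, 'b) fctr \<Rightarrow>
   ('o, 'a, 'p, 'b) fctr \<Rightarrow> ('o \<Rightarrow> 'b) \<Rightarrow> bool" where
  "natural_iso C D G H \<eta> \<longleftrightarrow> natural C D G H \<eta> \<and> (\<forall>X \<in> Obj C. iso_arr D (\<eta> X))"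

text \<open>A subcategory is given by its set of arrows; its objects are their domains and codomains.\<close>

definition subcategory :: "('o, 'a, 'x) cat_scheme \<Rightarrow> 'a set \<Rightarrow> bool" where
  "subcategory C S \<longleftrightarrow> S \<subseteq> Arr C \<and>
     (\<forall>f \<in> S. Idn C (Dom C f) \<in> S \<and> Idn C (Cod C f) \<in> S) \<and>
     (\<forall>f \<in> S. \<forall>g \<in> S. Dom C g = Cod C f \<longrightarrow> g \<cdot>\<^bsub>C\<^esub> f \<in> S)"

definition wide_subcategory :: "('o, 'a, 'x) cat_scheme \<Rightarrow> 'a set \<Rightarrow> bool" where
  "wide_subcategory C S \<longleftrightarrow> subcategory C S \<and> Idn C ` Obj C \<subseteq> S"

definition nat_part ::
  "('o, 'a, 'x) cat_scheme \<Rightarrow> ('p, 'b, 'y) cat_scheme \<Rightarrow> ('o, 'a, 'p, 'b) fctr \<Rightarrow>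
   ('o, 'a, 'p, 'b) fctr \<Rightarrow> ('o \<Rightarrow> 'b) \<Rightarrow> 'a set" where
  "nat_part C D G H \<eta> = \<Union> {S. wide_subcategory C S \<and> natural_on C D G H \<eta> S}"


section \<open>P-categories and dominical categories\<close>

record ('o, 'a) pcat = "('o, 'a) cat" +
  Box :: "('o \<times> 'o, 'a \<times> 'a, 'o, 'a) fctr"
  Diag :: "'o \<Rightarrow> 'a"
  Proj0 :: "'o \<times> 'o \<Rightarrow> 'a"
  Proj1 :: "'o \<times> 'o \<Rightarrow> 'a"

definition box_obj :: "('o, 'a, 'x) pcat_scheme \<Rightarrow> 'o \<Rightarrow> 'o \<Rightarrow> 'o" where
  "box_obj C X Y = OMap (Box C) (X, Y)"

definition box_arr :: "('o, 'a, 'x) pcat_scheme \<Rightarrow> 'a \<Rightarrow> 'a \<Rightarrow> 'a" where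
  "box_arr C f g = AMap (Box C) (f, g)"

definition angle :: "('o, 'a, 'x) pcat_scheme \<Rightarrow> 'a \<Rightarrow> 'a \<Rightarrow> 'a" where
  "angle C f g = box_arr C f g \<cdot>\<^bsub>C\<^esub> Diag C (Dom C f)"

definition assoc_arr :: "('o, 'a, 'x) pcat_scheme \<Rightarrow> 'o \<Rightarrow> 'o \<Rightarrow> 'o \<Rightarrow> 'a" where
  "assoc_arr C X Y Z =
     angle C (Proj0 C (X, Y) \<cdot>\<^bsub>C\<^esub> Proj0 C (box_obj C X Y, Z))
             (angle C (Proj1 C (X, Y) \<cdot>\<^bsub>C\<^esub> Proj0 C (box_obj C X Y, Z))
                      (Proj1 C (box_obj C X Y, Z)))"

definition swap_arr :: "('o, 'a, 'x) pcat_scheme \<Rightarrow> 'o \<Rightarrow> 'o \<Rightarrow> 'a" where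
  "swap_arr C X Y = angle C (Proj1 C (X, Y)) (Proj0 C (X, Y))"

definition proj_subcategory :: "('o, 'a, 'x) pcat_scheme \<Rightarrow> 'a set" where
  "proj_subcategory C = \<Inter> {S. subcategory C S \<and>
     (\<forall>f \<in> S. \<forall>g \<in> S. box_arr C f g \<in> S) \<and>
     (\<forall>X \<in> Obj C. \<forall>Y \<in> Obj C. Proj0 C (X, Y) \<in> S \<and> Proj1 C (X, Y) \<in> S)}"

definition P_category :: "('o, 'a, 'x) pcat_scheme \<Rightarrow> bool" where
  "P_category C \<longleftrightarrow>
     (let C2 = prod_cat C C; C3 = prod_cat C2 C;
          Pi0 = \<lparr>OMap = fst, AMap = fst\<rparr>; Pi1 = \<lparr>OMap = snd, AMap = snd\<rparr>;
          P = proj_subcategory C in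
      category C \<and>
      is_functor C2 C (Box C) \<and>
      natural C C \<lparr>OMap = id, AMap = id\<rparr>
        \<lparr>OMap = \<lambda>X. box_obj C X X, AMap = \<lambda>f. box_arr C f f\<rparr> (Diag C) \<and>
      infranatural C2 C (Box C) Pi0 (Proj0 C) \<and>
      infranatural C2 C (Box C) Pi1 (Proj1 C) \<and>
      (\<forall>X \<in> Obj C. Proj0 C (X, X) \<cdot>\<^bsub>C\<^esub> Diag C X = Idn C X \<and>
                     Proj1 C (X, X) \<cdot>\<^bsub>C\<^esub> Diag C X = Idn C X \<and>
                     box_arr C (Proj0 C (X, X)) (Proj1 C (X, X)) \<cdot>\<^bsub>C\<^esub> Diag C (box_obj C X X)
                       = Idn C (box_obj C X X)) \<and>
      Arr C \<times> P \<subseteq> nat_part C2 C (Box C) Pi0 (Proj0 C) \<and>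
      P \<times> Arr C \<subseteq> nat_part C2 C (Box C) Pi1 (Proj1 C) \<and>
      natural_iso C3 C
        \<lparr>OMap = \<lambda>((X, Y), Z). box_obj C (box_obj C X Y) Z,
         AMap = \<lambda>((f, g), h). box_arr C (box_arr C f g) h\<rparr>
        \<lparr>OMap = \<lambda>((X, Y), Z). box_obj C X (box_obj C Y Z),
         AMap = \<lambda>((f, g), h). box_arr C f (box_arr C g h)\<rparr>
        (\<lambda>((X, Y), Z). assoc_arr C X Y Z) \<and>
      natural_iso C2 C (Box C)
        \<lparr>OMap = \<lambda>(X, Y). box_obj C Y X, AMap = \<lambda>(f, g). box_arr C g f\<rparr>
        (\<lambda>(X, Y). swap_arr C X Y) \<and>
      (\<forall>W \<in> Obj C. \<forall>X \<in> Obj C. \<forall>Y \<in> Obj C. \<forall>Z \<in> Obj C.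
         assoc_arr C W X (box_obj C Y Z) \<cdot>\<^bsub>C\<^esub> assoc_arr C (box_obj C W X) Y Z =
         box_arr C (Idn C W) (assoc_arr C X Y Z) \<cdot>\<^bsub>C\<^esub>
           (assoc_arr C W (box_obj C X Y) Z \<cdot>\<^bsub>C\<^esub> box_arr C (assoc_arr C W X Y) (Idn C Z))) \<and>
      (\<forall>X \<in> Obj C. \<forall>Y \<in> Obj C. \<forall>Z \<in> Obj C.
         assoc_arr C Y Z X \<cdot>\<^bsub>C\<^esub> (swap_arr C X (box_obj C Y Z) \<cdot>\<^bsub>C\<^esub> assoc_arr C X Y Z) =
         box_arr C (Idn C Y) (swap_arr C X Z) \<cdot>\<^bsub>C\<^esub>
           (assoc_arr C Y X Z \<cdot>\<^bsub>C\<^esub> box_arr C (swap_arr C X Y) (Idn C Z))) \<and>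
      (\<forall>X \<in> Obj C. \<forall>Y \<in> Obj C.
         swap_arr C Y X \<cdot>\<^bsub>C\<^esub> swap_arr C X Y = Idn C (box_obj C X Y)))"

definition domain_arr :: "('o, 'a, 'x) pcat_scheme \<Rightarrow> 'a \<Rightarrow> 'a" where
  "domain_arr C f = Proj0 C (Dom C f, Cod C f) \<cdot>\<^bsub>C\<^esub> angle C (Idn C (Dom C f)) f"

definition total_arr :: "('o, 'a, 'x) pcat_scheme \<Rightarrow> 'a \<Rightarrow> bool" where
  "total_arr C f \<longleftrightarrow> domain_arr C f = Idn C (Dom C f)"

definition zero_system :: "('o, 'a, 'x) cat_scheme \<Rightarrow> ('o \<Rightarrow> 'o \<Rightarrow> 'a) \<Rightarrow> bool" where
  "zero_system C zero \<longleftrightarrow>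
     (\<forall>X \<in> Obj C. \<forall>Y \<in> Obj C. zero X Y \<in> hom C X Y) \<and>
     (\<forall>W \<in> Obj C. \<forall>X \<in> Obj C. \<forall>Y \<in> Obj C. \<forall>Z \<in> Obj C. \<forall>f \<in> hom C W X. \<forall>g \<in> hom C Y Z.
        g \<cdot>\<^bsub>C\<^esub> (zero X Y \<cdot>\<^bsub>C\<^esub> f) = zero W Z)"

definition weakly_total :: "('o, 'a, 'x) cat_scheme \<Rightarrow> ('o \<Rightarrow> 'o \<Rightarrow> 'a) \<Rightarrow> 'a \<Rightarrow> bool" where
  "weakly_total C zero f \<longleftrightarrow>
     (\<forall>W \<in> Obj C. \<forall>g \<in> hom C W (Dom C f).
        f \<cdot>\<^bsub>C\<^esub> g = zero W (Cod C f) \<longrightarrow> g = zero W (Dom C f))"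

definition prodominical_with :: "('o, 'a, 'x) pcat_scheme \<Rightarrow> ('o \<Rightarrow> 'o \<Rightarrow> 'a) \<Rightarrow> bool" where
  "prodominical_with C zero \<longleftrightarrow> P_category C \<and> zero_system C zero \<and>
     (\<forall>f \<in> Arr C. \<forall>X \<in> Obj C. \<forall>Y \<in> Obj C.
        box_arr C f (zero X Y) = zero (box_obj C (Dom C f) X) (box_obj C (Cod C f) Y))"

definition prodominical :: "('o, 'a, 'x) pcat_scheme \<Rightarrow> bool" where
  "prodominical C \<longleftrightarrow> (\<exists>zero. prodominical_with C zero)"

definition dominical :: "('o, 'a, 'x) pcat_scheme \<Rightarrow> bool" where
  "dominical C \<longleftrightarrow> (\<exists>zero. prodominical_with C zero \<and>
     (\<forall>f \<in> Arr C. weakly_total C zero f \<longrightarrow> total_arr C f) \<and>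
     (\<forall>f \<in> Arr C. \<forall>g \<in> Arr C.
        box_arr C f g = zero (box_obj C (Dom C f) (Dom C g)) (box_obj C (Cod C f) (Cod C g)) \<longrightarrow>
        f = zero (Dom C f) (Cod C f) \<or> g = zero (Dom C g) (Cod C g)))"


section \<open>Partial morphisms\<close>

text \<open>The product of two objects is a product cone picked by Hilbert choice.\<close>

definition chosen_cone :: "('o, 'a, 'x) cat_scheme \<Rightarrow> 'o \<Rightarrow> 'o \<Rightarrow> 'a \<times> 'a" where
  "chosen_cone K X Y = (SOME (p, q). product_cone K X Y p q)"

definition times_obj :: "('o, 'a, 'x) cat_scheme \<Rightarrow> 'o \<Rightarrow> 'o \<Rightarrow> 'o" where
  "times_obj K X Y = Dom K (fst (chosen_cone K X Y))"

definition tuple_arr :: "('o, 'a, 'x) cat_scheme \<Rightarrow> 'a \<Rightarrow> 'a \<Rightarrow> 'a" where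
  "tuple_arr K f g = (THE h. h \<in> hom K (Dom K f) (times_obj K (Cod K f) (Cod K g)) \<and>
     fst (chosen_cone K (Cod K f) (Cod K g)) \<cdot>\<^bsub>K\<^esub> h = f \<and>
     snd (chosen_cone K (Cod K f) (Cod K g)) \<cdot>\<^bsub>K\<^esub> h = g)"

definition times_arr :: "('o, 'a, 'x) cat_scheme \<Rightarrow> 'a \<Rightarrow> 'a \<Rightarrow> 'a" where
  "times_arr K f g = tuple_arr K (f \<cdot>\<^bsub>K\<^esub> fst (chosen_cone K (Dom K f) (Dom K g)))
                                 (g \<cdot>\<^bsub>K\<^esub> snd (chosen_cone K (Dom K f) (Dom K g)))"

definition spans :: "('o, 'a, 'x) cat_scheme \<Rightarrow> 'o \<Rightarrow> 'o \<Rightarrow> ('a \<times> 'a) set" where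
  "spans K X Y = {(m, \<phi>). mono_arr K m \<and> \<phi> \<in> Arr K \<and>
     Dom K m = Dom K \<phi> \<and> Cod K m = X \<and> Cod K \<phi> = Y}"

definition span_rel :: "('o, 'a, 'x) cat_scheme \<Rightarrow> 'o \<Rightarrow> 'o \<Rightarrow> (('a \<times> 'a) \<times> ('a \<times> 'a)) set" where
  "span_rel K X Y = {((m, \<phi>), (m', \<phi>')). (m, \<phi>) \<in> spans K X Y \<and> (m', \<phi>') \<in> spans K X Y \<and>
     (\<exists>\<theta> \<in> hom K (Dom K m) (Dom K m'). iso_arr K \<theta> \<and> m = m' \<cdot>\<^bsub>K\<^esub> \<theta> \<and> \<phi> = \<phi>' \<cdot>\<^bsub>K\<^esub> \<theta>)}"

text \<open>A morphism \<open>X \<rightarrow> Y\<close> of \<open>Pfn K\<close> is a triple \<open>(X, c, Y)\<close> where \<open>c\<close> is an equivalence class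
  of spans. Operations on classes that are given by representatives are written as the union of
  the resulting classes over all representatives (and all pullbacks); these classes all coincide
  when the operation is well defined.\<close>

type_synonym ('o, 'a) parr = "'o \<times> ('a \<times> 'a) set \<times> 'o"

definition span_class :: "('o, 'a, 'x) cat_scheme \<Rightarrow> 'a \<Rightarrow> 'a \<Rightarrow> ('a \<times> 'a) set" where
  "span_class K m \<phi> = span_rel K (Cod K m) (Cod K \<phi>) `` {(m, \<phi>)}"

definition embed_arr :: "('o, 'a, 'x) cat_scheme \<Rightarrow> 'a \<Rightarrow> ('o, 'a) parr" where
  "embed_arr K \<phi> = (Dom K \<phi>, span_class K (Idn K (Dom K \<phi>)) \<phi>, Cod K \<phi>)"

definition parr_comp :: "('o, 'a, 'x) cat_scheme \<Rightarrow> ('o, 'a) parr \<Rightarrow> ('o, 'a) parr \<Rightarrow> ('o, 'a) parr" where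
  "parr_comp K = (\<lambda>(Y', c', Z) (X, c, Y).
     (X, \<Union> {span_class K (m \<cdot>\<^bsub>K\<^esub> q) (\<phi>' \<cdot>\<^bsub>K\<^esub> r) | m \<phi> m' \<phi>' q r.
            (m, \<phi>) \<in> c \<and> (m', \<phi>') \<in> c' \<and> pullback K \<phi> m' q r}, Z))"

definition parr_box :: "('o, 'a, 'x) cat_scheme \<Rightarrow> ('o, 'a) parr \<Rightarrow> ('o, 'a) parr \<Rightarrow> ('o, 'a) parr" where
  "parr_box K = (\<lambda>(X, c, Y) (X', c', Y').
     (times_obj K X X',
      \<Union> {span_class K (times_arr K m m') (times_arr K \<phi> \<phi>') | m \<phi> m' \<phi>'.
            (m, \<phi>) \<in> c \<and> (m', \<phi>') \<in> c'},
      times_obj K Y Y'))"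

definition Pfn :: "('o, 'a, 'x) cat_scheme \<Rightarrow> ('o, ('o, 'a) parr) pcat" where
  "Pfn K =
     \<lparr>Obj = Obj K,
      Arr = {(X, c, Y). X \<in> Obj K \<and> Y \<in> Obj K \<and> c \<in> spans K X Y // span_rel K X Y},
      Dom = (\<lambda>(X, c, Y). X), Cod = (\<lambda>(X, c, Y). Y),
      Idn = (\<lambda>X. embed_arr K (Idn K X)),
      Comp = parr_comp K,
      Box = \<lparr>OMap = \<lambda>(X, Y). times_obj K X Y, AMap = \<lambda>(f, g). parr_box K f g\<rparr>,
      Diag = (\<lambda>X. embed_arr K (tuple_arr K (Idn K X) (Idn K X))),
      Proj0 = (\<lambda>(X, Y). embed_arr K (fst (chosen_cone K X Y))),
      Proj1 = (\<lambda>(X, Y). embed_arr K (snd (chosen_cone K X Y)))\<rparr>"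


section \<open>Sets and coalgebras\<close>

text \<open>The category of sets is taken relative to a Grothendieck universe. The universe is carried
  by a type \<open>'u\<close>, and its sets are the subsets of \<open>'u\<close> of cardinality smaller than that
  of \<open>'u\<close>. They have to be closed under power sets (up to bijection) and under small unions,
  i.e. the cardinality of \<open>'u\<close> is a regular strong limit. If \<open>'u\<close> is uncountable this is strong
  inaccessibility, and when \<open>'u\<close> is the set \<open>V\<^sub>\<kappa>\<close> with \<open>\<kappa>\<close> inaccessible the small subsets are
  precisely the elements of \<open>V\<^sub>\<kappa>\<close>. As in the usual definition of universes, an infinite member
  is not required.\<close>

definition small :: "'u set \<Rightarrow> bool" where
  "small A \<longleftrightarrow> A \<prec> (UNIV :: 'u set)"

definition grothendieck_universe :: "'u itself \<Rightarrow> bool" where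
  "grothendieck_universe _ \<longleftrightarrow>
     infinite (UNIV :: 'u set) \<and>
     (\<forall>A :: 'u set. small A \<longrightarrow> Pow A \<prec> (UNIV :: 'u set)) \<and>
     (\<forall>(I :: 'u set) (A :: 'u \<Rightarrow> 'u set). small I \<longrightarrow> (\<forall>i \<in> I. small (A i)) \<longrightarrow>
        small (\<Union>i \<in> I. A i))"

type_synonym 'u setarr = "'u set \<times> ('u \<Rightarrow> 'u) \<times> 'u set"

definition Set_cat :: "('u set, 'u setarr) cat" where
  "Set_cat =
     \<lparr>Obj = {A. small A},
      Arr = {(A, f, B). small A \<and> small B \<and> f \<in> A \<rightarrow>\<^sub>E B},
      Dom = (\<lambda>(A, f, B). A), Cod = (\<lambda>(A, f, B). B),
      Idn = (\<lambda>A. (A, restrict id A, A)),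
      Comp = (\<lambda>(B', g, C) (A, f, B). (A, compose A g f, C))\<rparr>"

type_synonym 'u set_endo = "('u set, 'u setarr, 'u set, 'u setarr) fctr"

definition Coalg ::
  "('o, 'a, 'x) cat_scheme \<Rightarrow> ('o, 'a, 'o, 'a) fctr \<Rightarrow>
   ('o \<times> 'a, ('o \<times> 'a) \<times> 'a \<times> ('o \<times> 'a)) cat" where
  "Coalg C F =
     (let coalgs = {(A, \<alpha>). A \<in> Obj C \<and> \<alpha> \<in> hom C A (OMap F A)} in
     \<lparr>Obj = coalgs,
      Arr = {((A, \<alpha>), \<phi>, (B, \<beta>)). (A, \<alpha>) \<in> coalgs \<and> (B, \<beta>) \<in> coalgs \<and>
               \<phi> \<in> hom C A B \<and> \<beta> \<cdot>\<^bsub>C\<^esub> \<phi> = AMap F \<phi> \<cdot>\<^bsub>C\<^esub> \<alpha>},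
      Dom = (\<lambda>(X, \<phi>, Y). X), Cod = (\<lambda>(X, \<phi>, Y). Y),
      Idn = (\<lambda>X. (X, Idn C (fst X), X)),
      Comp = (\<lambda>(Y', \<psi>, Z) (X, \<phi>, Y). (X, \<psi> \<cdot>\<^bsub>C\<^esub> \<phi>, Z))\<rparr>)"

definition nontrivial :: "'u set_endo \<Rightarrow> bool" where
  "nontrivial F \<longleftrightarrow> (\<forall>X. small X \<longrightarrow> OMap F X = {} \<longrightarrow> X = {})"

definition is_subcoalgebra :: "'u set_endo \<Rightarrow> 'u set \<Rightarrow> 'u set \<times> 'u setarr \<Rightarrow> bool" where
  "is_subcoalgebra F S X \<longleftrightarrow> S \<subseteq> fst X \<and>
     (\<exists>\<sigma>. ((S, \<sigma>), (S, restrict id S, fst X), X) \<in> Arr (Coalg Set_cat F))"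

text \<open>The bounding cardinal is that of a small set \<open>\<kappa>\<close>.\<close>

definition bounded_endo :: "'u set_endo \<Rightarrow> bool" where
  "bounded_endo F \<longleftrightarrow> (\<exists>\<kappa> :: 'u set. small \<kappa> \<and>
     (\<forall>X \<in> Obj (Coalg Set_cat F). \<forall>a \<in> fst X.
        \<exists>S. is_subcoalgebra F S X \<and> a \<in> S \<and> S \<lesssim> \<kappa>))"

end

theory Submission
  imports Defs
begin

text \<open>Take for \<open>F\<close> the constant functor with value a set \<open>D\<close> of two colours. A coalgebra is then a
  set whose elements are coloured by \<open>D\<close>, and a morphism is a colour-preserving map: \<open>Set\<^sub>F\<close> is the
  slice of sets over \<open>D\<close>, and its product is the fibre product over \<open>D\<close>. A one-point set of the
  first colour and a one-point set of the second colour therefore have an empty product. Their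
  identities are not zero, but the near product of these identities is the identity of the empty
  coalgebra, which is zero; so \<open>Pfn\<^sub>F\<close> has zero divisors for \<open>\<boxtimes>\<close> and cannot be dominical
  (\<open>Pfn_not_dominical\<close>). The functor itself is harmless. It sends every square to a square of
  identities, which is a pullback, and every subset of a coloured set is a subcoalgebra, so that one
  point bounds the subcoalgebra generated by an element.

  What has to be shown is that \<open>Pfn\<^sub>F\<close> is prodominical, and this holds for any set of colours. A
  monomorphism is injective, so a span \<open>(m, f)\<close> has a graph
  \<open>{(m u, f u)}\<close> that is a partial function preserving colours. Spans are equivalent precisely
  when their graphs agree (\<open>span_rel_iff\<close>), and every such partial function is the graph of a span
  on its domain of definition (\<open>span_of_graph\<close>). Under this correspondence composition by pullback
  becomes the composition of relations (\<open>parr_comp_pmor\<close>) and the near product acts on both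
  coordinates independently (\<open>parr_box_pmor\<close>). The axioms of a \<open>P\<close>-category are then statements
  about partial functions that can be checked point by point, and the empty partial function is the
  zero morphism.

  Pullbacks and the chosen products are known only up to isomorphism. Their elements are reached by
  testing universal properties on one-point coalgebras: an element \<open>x\<close> of \<open>X\<close> is the same as a
  morphism to \<open>X\<close> from a point that has the colour of \<open>x\<close>. Hence an element of the product of \<open>X\<close>
  and \<open>Y\<close> is the same as a pair of elements of equal colour (\<open>pair_unique\<close>), and an element of a
  pullback is the same as a pair of elements with a common image (\<open>pullback_points\<close>).\<close>

section \<open>Coalgebras of a constant functor are coloured sets\<close>

definition const_endo :: "'u set \<Rightarrow> 'u set_endo" where
  "const_endo D = \<lparr>OMap = \<lambda>_. D, AMap = \<lambda>_. (D, restrict id D, D)\<rparr>"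

text \<open>The structure map of a coalgebra \<open>X\<close> is stored as an arrow of sets; only the underlying
  function carries information.\<close>

definition colour :: "'u set \<times> 'u setarr \<Rightarrow> 'u \<Rightarrow> 'u" where
  "colour X = fst (snd (snd X))"

definition apply_arr :: "'o \<times> 'u setarr \<times> 'o \<Rightarrow> 'u \<Rightarrow> 'u" where
  "apply_arr f = fst (snd (fst (snd f)))"

text \<open>Arrows of sets are extensional functions. The restriction built into \<open>mor\<close> makes any
  function that agrees with a morphism on the carrier an admissible representative of it.\<close>

definition mor ::
  "'u set \<times> 'u setarr \<Rightarrow> ('u \<Rightarrow> 'u) \<Rightarrow> 'u set \<times> 'u setarr \<Rightarrow>
   ('u set \<times> 'u setarr) \<times> 'u setarr \<times> ('u set \<times> 'u setarr)" where
  "mor X f Y = (X, (fst X, restrict f (fst X), fst Y), Y)"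

definition colour_map ::
  "'u set \<times> 'u setarr \<Rightarrow> 'u set \<times> 'u setarr \<Rightarrow> ('u \<Rightarrow> 'u) \<Rightarrow> bool" where
  "colour_map X Y f \<longleftrightarrow> (\<forall>x \<in> fst X. f x \<in> fst Y \<and> colour Y (f x) = colour X x)"

locale coloured_sets =
  fixes D :: "'u set"
  assumes universe: "grothendieck_universe TYPE('u)"
    and small_D: "small D"
begin

abbreviation K where "K \<equiv> Coalg Set_cat (const_endo D)"

lemma small_subset: "small B \<Longrightarrow> A \<subseteq> B \<Longrightarrow> small (A :: 'u set)"
  unfolding small_def using lesspoll_trans1 subset_imp_lepoll by blast

lemma small_image: "small A \<Longrightarrow> small (f ` A :: 'u set)" for A :: "'u set"
  unfolding small_def using lesspoll_trans1 image_lepoll by blast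

lemma small_finite: "finite A \<Longrightarrow> small (A :: 'u set)"
  using universe unfolding small_def grothendieck_universe_def
  by (simp add: finite_lesspoll_infinite)

lemma small_UN: "small I \<Longrightarrow> (\<And>i. i \<in> I \<Longrightarrow> small (A i)) \<Longrightarrow> small (\<Union>i\<in>I. A i)"
  for I :: "'u set" and A :: "'u \<Rightarrow> 'u set"
  using universe unfolding grothendieck_universe_def by simp

lemma const_functor: "is_functor Set_cat Set_cat (const_endo D)"
  using small_D
  by (auto simp: is_functor_def const_endo_def Set_cat_def hom_def compose_def restrict_def)

text \<open>The image of any square is the square of identities of \<open>D\<close>, so a cone over it consists of two
  equal arrows, and each of them is the mediating arrow.\<close>

lemma const_weakly_preserves_pullbacks:
  "weakly_preserves_pullbacks Set_cat Set_cat (const_endo D)"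
proof -
  have id: "(D, restrict id D, D) \<in> Arr Set_cat"
    using small_D by (auto simp: Set_cat_def)
  have comp_id: "(D, restrict id D, D) \<cdot>\<^bsub>Set_cat\<^esub> f = f"
    if "f \<in> Arr Set_cat" "Cod Set_cat f = D" for f
    using that
    by (auto simp: Set_cat_def compose_def restrict_def PiE_def extensional_def fun_eq_iff Pi_def)
  have dc: "Dom Set_cat (D, restrict id D, D) = D" "Cod Set_cat (D, restrict id D, D) = D"
    by (auto simp: Set_cat_def)
  have "weak_pullback Set_cat (D, restrict id D, D) (D, restrict id D, D)
      (D, restrict id D, D) (D, restrict id D, D)"
    unfolding weak_pullback_def
  proof (intro conjI allI impI)
    show "commuting_square Set_cat (D, restrict id D, D) (D, restrict id D, D)
      (D, restrict id D, D) (D, restrict id D, D)"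
      using id dc by (simp add: commuting_square_def)
  next
    fix q r
    assume sq: "commuting_square Set_cat (D, restrict id D, D) (D, restrict id D, D) q r"
    then have qr: "q \<in> Arr Set_cat" "r \<in> Arr Set_cat" "Cod Set_cat q = D" "Cod Set_cat r = D"
      using dc by (simp_all add: commuting_square_def)
    moreover have "q = r"
      using sq comp_id[OF qr(1,3)] comp_id[OF qr(2,4)] by (simp add: commuting_square_def)
    ultimately show "\<exists>h. h \<in> hom Set_cat (Dom Set_cat q) (Dom Set_cat (D, restrict id D, D)) \<and>
        (D, restrict id D, D) \<cdot>\<^bsub>Set_cat\<^esub> h = q \<and> (D, restrict id D, D) \<cdot>\<^bsub>Set_cat\<^esub> h = r"
      using comp_id[OF qr(1,3)] dc by (intro exI[of _ q]) (auto simp: hom_def)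
  qed
  then show ?thesis
    by (simp add: weakly_preserves_pullbacks_def const_endo_def)
qed

lemma Obj_K:
  "X \<in> Obj K \<longleftrightarrow>
     small (fst X) \<and> colour X \<in> fst X \<rightarrow>\<^sub>E D \<and> X = (fst X, (fst X, colour X, D))"
  using small_D
  by (cases X) (auto simp: Coalg_def Set_cat_def const_endo_def hom_def colour_def Let_def)

lemma colour_in_D: "X \<in> Obj K \<Longrightarrow> x \<in> fst X \<Longrightarrow> colour X x \<in> D"
  by (auto simp: Obj_K)

lemma Dom_K [simp]: "Dom K f = fst f" and Cod_K [simp]: "Cod K f = snd (snd f)"
  by (auto simp: Coalg_def Let_def split_beta)

lemma mor_simps [simp]:
  "fst (mor X f Y) = X" "snd (snd (mor X f Y)) = Y"
  "x \<in> fst X \<Longrightarrow> apply_arr (mor X f Y) x = f x"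
  by (auto simp: mor_def apply_arr_def)

lemma mor_eq_iff: "mor X f Y = mor X g Y \<longleftrightarrow> (\<forall>x \<in> fst X. f x = g x)"
  by (auto simp: mor_def fun_eq_iff restrict_def)

lemma mor_in_Arr:
  assumes "X \<in> Obj K" "Y \<in> Obj K" "colour_map X Y f"
  shows "mor X f Y \<in> Arr K"
proof -
  obtain A a where X: "X = (A, (A, a, D))" "small A" "a \<in> A \<rightarrow>\<^sub>E D"
    using assms(1) unfolding Obj_K by metis
  obtain B b where Y: "Y = (B, (B, b, D))" "small B" "b \<in> B \<rightarrow>\<^sub>E D"
    using assms(2) unfolding Obj_K by metis
  have "\<forall>x\<in>A. f x \<in> B \<and> b (f x) = a x"
    using assms(3) by (auto simp: colour_map_def X(1) Y(1) colour_def)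
  then show ?thesis
    using X Y small_D
    by (auto simp: mor_def Coalg_def Set_cat_def const_endo_def hom_def compose_def restrict_def
        fun_eq_iff PiE_def extensional_def Let_def Pi_def)
qed

text \<open>The coalgebra square of a morphism says that it preserves colours, because \<open>F\<close> sends the
  morphism to the identity of \<open>D\<close>.\<close>

lemma ArrD:
  assumes "f \<in> Arr K"
  shows "fst f \<in> Obj K" "snd (snd f) \<in> Obj K" "f = mor (fst f) (apply_arr f) (snd (snd f))"
    "colour_map (fst f) (snd (snd f)) (apply_arr f)"
proof -
  obtain A a B b \<phi> where f: "f = ((A, a), \<phi>, (B, b))"
    by (metis prod.collapse)
  obtain h where \<phi>: "\<phi> = (A, h, B)" and h: "h \<in> A \<rightarrow>\<^sub>E B"
    using assms unfolding f by (auto simp: Coalg_def Set_cat_def hom_def Let_def)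
  obtain \<alpha> \<beta> where ab: "a = (A, \<alpha>, D)" "b = (B, \<beta>, D)" "\<alpha> \<in> A \<rightarrow>\<^sub>E D" "\<beta> \<in> B \<rightarrow>\<^sub>E D"
    using assms unfolding f by (auto simp: Coalg_def Set_cat_def const_endo_def hom_def Let_def)
  have sm: "small A" "small B"
    using assms unfolding f by (auto simp: Coalg_def Set_cat_def const_endo_def hom_def Let_def)
  have "compose A \<beta> h = compose A (restrict id D) \<alpha>"
    using assms unfolding f \<phi> ab
    by (auto simp: Coalg_def Set_cat_def const_endo_def hom_def Let_def)
  then have "\<forall>x\<in>A. \<beta> (h x) = \<alpha> x"
    using ab(3) by (metis PiE_mem compose_eq id_apply restrict_apply')
  then show "colour_map (fst f) (snd (snd f)) (apply_arr f)"
    using h by (auto simp: f \<phi> ab colour_map_def colour_def apply_arr_def)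
  show "fst f \<in> Obj K" "snd (snd f) \<in> Obj K"
    using ab sm by (auto simp: f Obj_K colour_def)
  show "f = mor (fst f) (apply_arr f) (snd (snd f))"
    using h by (auto simp: f \<phi> mor_def apply_arr_def fun_eq_iff restrict_def PiE_def extensional_def)
qed

lemma Arr_iff:
  "f \<in> Arr K \<longleftrightarrow> (\<exists>X\<in>Obj K. \<exists>Y\<in>Obj K. \<exists>h. colour_map X Y h \<and> f = mor X h Y)"
  using ArrD mor_in_Arr by metis

lemma hom_K:
  assumes "X \<in> Obj K" "Y \<in> Obj K"
  shows "f \<in> hom K X Y \<longleftrightarrow> (\<exists>h. colour_map X Y h \<and> f = mor X h Y)"
  using assms by (auto simp: hom_def Arr_iff)

lemma Comp_mor:
  assumes "colour_map X Y f"
  shows "mor Y g Z \<cdot>\<^bsub>K\<^esub> mor X f Y = mor X (\<lambda>x. g (f x)) Z"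
  using assms
  by (auto simp: mor_def Coalg_def Set_cat_def Let_def compose_def restrict_def fun_eq_iff colour_map_def)

lemma Idn_K: "Idn K X = mor X (\<lambda>x. x) X"
  by (auto simp: mor_def Coalg_def Set_cat_def Let_def restrict_def fun_eq_iff)

lemma colour_mapD: "colour_map X Y f \<Longrightarrow> x \<in> fst X \<Longrightarrow> f x \<in> fst Y \<and> colour Y (f x) = colour X x"
  by (simp add: colour_map_def)

lemma colour_map_comp: "colour_map X Y f \<Longrightarrow> colour_map Y Z g \<Longrightarrow> colour_map X Z (\<lambda>x. g (f x))"
  by (auto simp: colour_map_def)

lemma colour_map_id: "colour_map X X (\<lambda>x. x)"
  by (auto simp: colour_map_def)

text \<open>Every subset of a coloured set inherits the colouring. One-element subsets serve as test objects,
  and the domain of definition of a partial function is realised in this way as the source of a span.\<close>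

definition sub :: "'u set \<times> 'u setarr \<Rightarrow> 'u set \<Rightarrow> 'u set \<times> 'u setarr" where
  "sub X S = (S, (S, restrict (colour X) S, D))"

lemma sub_simps [simp]: "fst (sub X S) = S" "x \<in> S \<Longrightarrow> colour (sub X S) x = colour X x"
  by (auto simp: sub_def colour_def)

lemma sub_in_Obj: "X \<in> Obj K \<Longrightarrow> S \<subseteq> fst X \<Longrightarrow> sub X S \<in> Obj K"
  using small_subset by (auto simp: Obj_K sub_def colour_def)

text \<open>The inclusion of a single point preserves colours, so each point is a subcoalgebra.\<close>

lemma const_bounded: "bounded_endo (const_endo D)"
  unfolding bounded_endo_def
proof (rule exI[of _ "{undefined}"], intro conjI ballI)
  show "small {undefined :: 'u}" by (simp add: small_finite)
next
  fix X a assume X: "X \<in> Obj K" and a: "a \<in> fst X"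
  have eq: "(sub X {a}, ({a}, restrict id {a}, fst X), X) = mor (sub X {a}) id X"
    by (simp add: mor_def)
  have "mor (sub X {a}) id X \<in> Arr K"
    using X a by (auto intro!: mor_in_Arr sub_in_Obj simp: colour_map_def)
  then have "is_subcoalgebra (const_endo D) {a} X"
    using a eq unfolding is_subcoalgebra_def sub_def by (metis empty_subsetI insert_subset)
  then show "\<exists>S. is_subcoalgebra (const_endo D) S X \<and> a \<in> S \<and> S \<lesssim> {undefined :: 'u}"
    by (intro exI[of _ "{a}"]) (auto simp: singleton_lepoll)
qed

text \<open>If \<open>f x = f y\<close>, then \<open>x\<close> and \<open>y\<close> have the same colour, so both are images of one coloured point
  under maps that become equal after \<open>f\<close>.\<close>

lemma mono_iff_inj:
  assumes "X \<in> Obj K" "Y \<in> Obj K" "colour_map X Y f"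
  shows "mono_arr K (mor X f Y) \<longleftrightarrow> inj_on f (fst X)"
proof
  assume mono: "mono_arr K (mor X f Y)"
  show "inj_on f (fst X)"
  proof (rule inj_onI)
    fix x y assume xy: "x \<in> fst X" "y \<in> fst X" "f x = f y"
    let ?T = "sub X {x}"
    have T: "?T \<in> Obj K" using assms xy by (auto intro!: sub_in_Obj)
    have cm: "colour_map ?T X (\<lambda>_. x)" "colour_map ?T X (\<lambda>_. y)"
      using assms(3) xy by (auto simp: colour_map_def) metis
    have "mor ?T (\<lambda>_. x) X = mor ?T (\<lambda>_. y) X"
      using mono unfolding mono_arr_def
      using mor_in_Arr[OF T assms(1) cm(1)] mor_in_Arr[OF T assms(1) cm(2)]
      by (auto simp: Comp_mor[OF cm(1)] Comp_mor[OF cm(2)] xy)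
    then show "x = y" by (simp add: mor_eq_iff)
  qed
next
  assume inj: "inj_on f (fst X)"
  show "mono_arr K (mor X f Y)"
    unfolding mono_arr_def
  proof (intro conjI ballI impI)
    show "mor X f Y \<in> Arr K" using assms by (rule mor_in_Arr)
  next
    fix g h assume g: "g \<in> Arr K" and h: "h \<in> Arr K"
      and d: "Dom K g = Dom K h" "Cod K g = Dom K (mor X f Y)" "Cod K h = Dom K (mor X f Y)"
      and eq: "mor X f Y \<cdot>\<^bsub>K\<^esub> g = mor X f Y \<cdot>\<^bsub>K\<^esub> h"
    obtain T g' where g': "g = mor T g' X" "colour_map T X g'"
      using ArrD[OF g] d by (metis Dom_K Cod_K mor_simps(1))
    obtain h' where h': "h = mor T h' X" "colour_map T X h'"
      using ArrD[OF h] d by (metis Dom_K Cod_K mor_simps(1) g'(1))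
    show "g = h"
      using eq inj g' h' by (auto simp: Comp_mor mor_eq_iff colour_map_def inj_on_def)
  qed
qed


section \<open>Products\<close>

lemma point_map:
  assumes "X \<in> Obj K" "x \<in> fst X" "Y \<in> Obj K" "y \<in> fst Y" "colour Y y = colour X x"
  shows "colour_map (sub X {x}) Y (\<lambda>_. y)"
  using assms by (auto simp: colour_map_def)

text \<open>The universe is closed under small unions, which makes small products small: embedded
  into the universe by a pairing function, \<open>A \<times> B\<close> is the union over \<open>a\<close> in \<open>A\<close> of copies of \<open>B\<close>.\<close>

lemma small_product: "\<exists>e :: 'u \<times> 'u \<Rightarrow> 'u. inj e \<and>
    (\<forall>A B. small A \<longrightarrow> small B \<longrightarrow> small (e ` (A \<times> B)))"
proof -
  have "infinite (UNIV :: 'u set)"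
    using universe by (simp add: grothendieck_universe_def)
  then have "(card_of (UNIV \<times> UNIV :: ('u \<times> 'u) set), card_of (UNIV :: 'u set)) \<in> ordIso"
    by (rule card_of_Times_same_infinite)
  then obtain e :: "'u \<times> 'u \<Rightarrow> 'u" where e: "bij_betw e (UNIV \<times> UNIV) UNIV"
    using card_of_ordIso by blast
  have "small (e ` (A \<times> B))" if AB: "small A" "small B" for A B
  proof -
    have "small (\<Union>a\<in>A. (\<lambda>b. e (a, b)) ` B)"
      by (intro small_UN AB small_image)
    moreover have "(\<Union>a\<in>A. (\<lambda>b. e (a, b)) ` B) = e ` (A \<times> B)" by auto
    ultimately show ?thesis by simp
  qed
  then show ?thesis using e by (auto simp: bij_betw_def)
qed

text \<open>The pairs of equal colour, coded in the universe, carry the product.\<close>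

lemma product_cone_exists:
  assumes X: "X \<in> Obj K" and Y: "Y \<in> Obj K"
  shows "\<exists>p q. product_cone K X Y p q"
proof -
  obtain e :: "'u \<times> 'u \<Rightarrow> 'u" where e: "inj e"
    "\<And>A B. small A \<Longrightarrow> small B \<Longrightarrow> small (e ` (A \<times> B))"
    using small_product by blast
  define S where "S = {(x, y). x \<in> fst X \<and> y \<in> fst Y \<and> colour X x = colour Y y}"
  define l where "l z = fst (inv e z)" for z
  define r where "r z = snd (inv e z)" for z
  have le [simp]: "l (e (x, y)) = x" "r (e (x, y)) = y" for x y
    using e(1) by (auto simp: l_def r_def)
  define P where "P = (e ` S, (e ` S, restrict (\<lambda>z. colour X (l z)) (e ` S), D))"
  have Pcol: "colour P = restrict (\<lambda>z. colour X (l z)) (e ` S)"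
    by (simp add: P_def colour_def)
  have Pc: "colour P z = colour X (l z)" if "z \<in> e ` S" for z
    using that by (simp add: P_def colour_def)
  have Pf: "fst P = e ` S" by (simp add: P_def)
  have "small (e ` (fst X \<times> fst Y))" using X Y e(2) by (simp add: Obj_K)
  then have "small (e ` S)"
    by (rule small_subset) (auto simp: S_def)
  then have P: "P \<in> Obj K"
    using colour_in_D[OF Y] unfolding Obj_K Pf Pcol by (auto simp: S_def) (simp add: P_def S_def)
  have lm: "colour_map P X l" and rm: "colour_map P Y r"
    by (auto simp: colour_map_def Pf Pc S_def)
  have "product_cone K X Y (mor P l X) (mor P r Y)"
    unfolding product_cone_def
  proof (intro conjI ballI)
    fix W f g assume W: "W \<in> Obj K" and f: "f \<in> hom K W X" and g: "g \<in> hom K W Y"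
    obtain f' where f': "f = mor W f' X" "colour_map W X f'" using f hom_K W X by blast
    obtain g' where g': "g = mor W g' Y" "colour_map W Y g'" using g hom_K W Y by blast
    let ?h = "\<lambda>w. e (f' w, g' w)"
    have h: "colour_map W P ?h"
      using f' g' by (auto simp: colour_map_def Pf Pc S_def)
    show "\<exists>!h. h \<in> hom K W (Dom K (mor P l X)) \<and>
        mor P l X \<cdot>\<^bsub>K\<^esub> h = f \<and> mor P r Y \<cdot>\<^bsub>K\<^esub> h = g"
    proof (rule ex1I[of _ "mor W ?h P"])
      show "mor W ?h P \<in> hom K W (Dom K (mor P l X)) \<and>
          mor P l X \<cdot>\<^bsub>K\<^esub> mor W ?h P = f \<and> mor P r Y \<cdot>\<^bsub>K\<^esub> mor W ?h P = g"
        using h W P by (auto simp: hom_K Comp_mor f' g')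
    next
      fix h assume "h \<in> hom K W (Dom K (mor P l X)) \<and>
          mor P l X \<cdot>\<^bsub>K\<^esub> h = f \<and> mor P r Y \<cdot>\<^bsub>K\<^esub> h = g"
      then obtain h' where h': "h = mor W h' P" "colour_map W P h'"
          "mor P l X \<cdot>\<^bsub>K\<^esub> h = f" "mor P r Y \<cdot>\<^bsub>K\<^esub> h = g"
        using W P by (auto simp: hom_K)
      have "h' w = ?h w" if w: "w \<in> fst W" for w
      proof -
        have "l (h' w) = f' w" "r (h' w) = g' w"
          using h' w by (auto simp: Comp_mor f' g' mor_eq_iff)
        moreover have "h' w \<in> e ` S" using h'(2) w by (auto simp: colour_map_def Pf)
        ultimately show ?thesis by auto
      qed
      then show "h = mor W ?h P" by (simp add: h' mor_eq_iff)
    qed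
  qed (use X Y P lm rm in \<open>auto intro: mor_in_Arr\<close>)
  then show ?thesis by blast
qed

definition prj0 where "prj0 X Y = apply_arr (fst (chosen_cone K X Y))"
definition prj1 where "prj1 X Y = apply_arr (snd (chosen_cone K X Y))"
abbreviation fib_prod where "fib_prod X Y \<equiv> times_obj K X Y"

text \<open>The chosen product is known only up to isomorphism, so a pair is described by its two
  projections; it exists when the components have the same colour.\<close>

definition pair where
  "pair X Y x y = (THE z. z \<in> fst (fib_prod X Y) \<and> prj0 X Y z = x \<and> prj1 X Y z = y)"

lemma chosen_cone_product:
  assumes "X \<in> Obj K" "Y \<in> Obj K"
  shows "product_cone K X Y (fst (chosen_cone K X Y)) (snd (chosen_cone K X Y))"
proof -
  have "\<exists>c. case c of (p, q) \<Rightarrow> product_cone K X Y p q"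
    using product_cone_exists[OF assms] by auto
  then have "case chosen_cone K X Y of (p, q) \<Rightarrow> product_cone K X Y p q"
    unfolding chosen_cone_def by (rule someI_ex)
  then show ?thesis by (simp add: split_beta)
qed

lemma chosen_cone_mor:
  assumes X: "X \<in> Obj K" and Y: "Y \<in> Obj K"
  shows "fib_prod X Y \<in> Obj K"
    and "fst (chosen_cone K X Y) = mor (fib_prod X Y) (prj0 X Y) X"
    and "snd (chosen_cone K X Y) = mor (fib_prod X Y) (prj1 X Y) Y"
    and "colour_map (fib_prod X Y) X (prj0 X Y)"
    and "colour_map (fib_prod X Y) Y (prj1 X Y)"
  using chosen_cone_product[OF assms] ArrD[of "fst (chosen_cone K X Y)"]
    ArrD[of "snd (chosen_cone K X Y)"]
  by (auto simp: product_cone_def prj0_def prj1_def times_obj_def)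

lemma product_mediating:
  assumes X: "X \<in> Obj K" and Y: "Y \<in> Obj K" and W: "W \<in> Obj K"
    and f: "colour_map W X f" and g: "colour_map W Y g"
  shows "\<exists>!h. h \<in> hom K W (fib_prod X Y) \<and>
      mor (fib_prod X Y) (prj0 X Y) X \<cdot>\<^bsub>K\<^esub> h = mor W f X \<and>
      mor (fib_prod X Y) (prj1 X Y) Y \<cdot>\<^bsub>K\<^esub> h = mor W g Y"
proof -
  have "mor W f X \<in> hom K W X" "mor W g Y \<in> hom K W Y"
    using assms hom_K by blast+
  then show ?thesis
    using chosen_cone_product[OF X Y] W
    unfolding product_cone_def chosen_cone_mor(2,3)[OF X Y] by simp
qed

text \<open>Maps from a point with the colour of \<open>x\<close> into the product correspond, by the universal property,
  to pairs of maps into the factors, that is, to pairs of elements of that colour.\<close>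

lemma pair_unique:
  assumes X: "X \<in> Obj K" and Y: "Y \<in> Obj K" and x: "x \<in> fst X" and y: "y \<in> fst Y"
    and c: "colour X x = colour Y y"
  shows "\<exists>!z. z \<in> fst (fib_prod X Y) \<and> prj0 X Y z = x \<and> prj1 X Y z = y"
proof -
  let ?T = "sub X {x}"
  have T: "?T \<in> Obj K" using X x by (auto intro!: sub_in_Obj)
  note cone = chosen_cone_mor[OF X Y]
  have ex1: "\<exists>!h. h \<in> hom K ?T (fib_prod X Y) \<and>
      mor (fib_prod X Y) (prj0 X Y) X \<cdot>\<^bsub>K\<^esub> h = mor ?T (\<lambda>_. x) X \<and>
      mor (fib_prod X Y) (prj1 X Y) Y \<cdot>\<^bsub>K\<^esub> h = mor ?T (\<lambda>_. y) Y"
    using X Y T x y c by (intro product_mediating point_map) auto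
  have point: "mor ?T (\<lambda>_. z) (fib_prod X Y) \<in> hom K ?T (fib_prod X Y) \<and>
      mor (fib_prod X Y) (prj0 X Y) X \<cdot>\<^bsub>K\<^esub> mor ?T (\<lambda>_. z) (fib_prod X Y) = mor ?T (\<lambda>_. x) X \<and>
      mor (fib_prod X Y) (prj1 X Y) Y \<cdot>\<^bsub>K\<^esub> mor ?T (\<lambda>_. z) (fib_prod X Y) = mor ?T (\<lambda>_. y) Y"
    if z: "z \<in> fst (fib_prod X Y)" "prj0 X Y z = x" "prj1 X Y z = y" for z
  proof -
    have "colour_map ?T (fib_prod X Y) (\<lambda>_. z)"
      using z cone(4) X x cone(1) by (intro point_map) (auto simp: colour_map_def)
    then show ?thesis using T cone(1) z by (auto simp: hom_K Comp_mor)
  qed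
  show ?thesis
  proof (rule ex_ex1I)
    obtain h where h: "colour_map ?T (fib_prod X Y) h"
      "mor (fib_prod X Y) (prj0 X Y) X \<cdot>\<^bsub>K\<^esub> mor ?T h (fib_prod X Y) = mor ?T (\<lambda>_. x) X"
      "mor (fib_prod X Y) (prj1 X Y) Y \<cdot>\<^bsub>K\<^esub> mor ?T h (fib_prod X Y) = mor ?T (\<lambda>_. y) Y"
      using ex1_implies_ex[OF ex1] unfolding hom_K[OF T cone(1)] by blast
    then show "\<exists>z. z \<in> fst (fib_prod X Y) \<and> prj0 X Y z = x \<and> prj1 X Y z = y"
      by (intro exI[of _ "h x"]) (auto simp: Comp_mor mor_eq_iff colour_map_def)
  next
    fix z z' assume z: "z \<in> fst (fib_prod X Y) \<and> prj0 X Y z = x \<and> prj1 X Y z = y"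
      and z': "z' \<in> fst (fib_prod X Y) \<and> prj0 X Y z' = x \<and> prj1 X Y z' = y"
    then have "mor ?T (\<lambda>_. z) (fib_prod X Y) = mor ?T (\<lambda>_. z') (fib_prod X Y)"
      using ex1 point by blast
    then show "z = z'" by (simp add: mor_eq_iff)
  qed
qed

lemma times_Obj [simp]: "X \<in> Obj K \<Longrightarrow> Y \<in> Obj K \<Longrightarrow> fib_prod X Y \<in> Obj K"
  by (rule chosen_cone_mor)

lemma prj_in [simp]:
  assumes "X \<in> Obj K" "Y \<in> Obj K" "z \<in> fst (fib_prod X Y)"
  shows "prj0 X Y z \<in> fst X" "prj1 X Y z \<in> fst Y"
    "colour X (prj0 X Y z) = colour (fib_prod X Y) z"
    "colour Y (prj1 X Y z) = colour (fib_prod X Y) z"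
  using chosen_cone_mor[OF assms(1,2)] assms(3) by (auto simp: colour_map_def)

lemma pair_in [simp]:
  assumes "X \<in> Obj K" "Y \<in> Obj K" "x \<in> fst X" "y \<in> fst Y" "colour X x = colour Y y"
  shows "pair X Y x y \<in> fst (fib_prod X Y)" "prj0 X Y (pair X Y x y) = x"
    "prj1 X Y (pair X Y x y) = y" "colour (fib_prod X Y) (pair X Y x y) = colour Y y"
proof -
  show *: "pair X Y x y \<in> fst (fib_prod X Y)" "prj0 X Y (pair X Y x y) = x"
    "prj1 X Y (pair X Y x y) = y"
    using theI'[OF pair_unique[OF assms]] by (auto simp: pair_def)
  show "colour (fib_prod X Y) (pair X Y x y) = colour Y y"
    using prj_in(4)[OF assms(1,2) *(1)] *(3) by simp
qed

lemma pair_prj [simp]: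
  assumes "X \<in> Obj K" "Y \<in> Obj K" "z \<in> fst (fib_prod X Y)"
  shows "pair X Y (prj0 X Y z) (prj1 X Y z) = z"
  unfolding pair_def
  using pair_unique[OF assms(1,2), of "prj0 X Y z" "prj1 X Y z"] assms
  by (intro the1_equality) auto

lemma times_eqI:
  assumes "X \<in> Obj K" "Y \<in> Obj K" "z \<in> fst (fib_prod X Y)" "z' \<in> fst (fib_prod X Y)"
    "prj0 X Y z = prj0 X Y z'" "prj1 X Y z = prj1 X Y z'"
  shows "z = z'"
  using assms pair_prj by metis

lemma pair_eqI:
  assumes "X \<in> Obj K" "Y \<in> Obj K" "z \<in> fst (fib_prod X Y)" "prj0 X Y z = x" "prj1 X Y z = y"
  shows "z = pair X Y x y"
  unfolding assms(4,5)[symmetric] using pair_prj[OF assms(1-3)] by (rule sym)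

lemma tuple_mor:
  assumes X: "X \<in> Obj K" and Y: "Y \<in> Obj K" and W: "W \<in> Obj K"
    and f: "colour_map W X f" and g: "colour_map W Y g"
  shows "tuple_arr K (mor W f X) (mor W g Y) = mor W (\<lambda>w. pair X Y (f w) (g w)) (fib_prod X Y)"
    and "colour_map W (fib_prod X Y) (\<lambda>w. pair X Y (f w) (g w))"
proof -
  let ?h = "\<lambda>w. pair X Y (f w) (g w)"
  show h: "colour_map W (fib_prod X Y) ?h"
    using X Y f g by (auto simp: colour_map_def)
  have "mor W ?h (fib_prod X Y) \<in> hom K W (fib_prod X Y)"
    using h hom_K[OF W times_Obj[OF X Y]] by blast
  then have "mor W ?h (fib_prod X Y) \<in> hom K W (fib_prod X Y) \<and>
      mor (fib_prod X Y) (prj0 X Y) X \<cdot>\<^bsub>K\<^esub> mor W ?h (fib_prod X Y) = mor W f X \<and>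
      mor (fib_prod X Y) (prj1 X Y) Y \<cdot>\<^bsub>K\<^esub> mor W ?h (fib_prod X Y) = mor W g Y"
    using X Y f g by (auto simp: Comp_mor[OF h] mor_eq_iff colour_map_def)
  then show "tuple_arr K (mor W f X) (mor W g Y) = mor W ?h (fib_prod X Y)"
    unfolding tuple_arr_def
    by (intro the1_equality) (use product_mediating[OF assms] in \<open>auto simp: chosen_cone_mor(2,3)[OF X Y]\<close>)
qed

lemma times_mor:
  assumes obj: "X \<in> Obj K" "Y \<in> Obj K" "X' \<in> Obj K" "Y' \<in> Obj K"
    and f: "colour_map X Y f" and g: "colour_map X' Y' g"
  shows "times_arr K (mor X f Y) (mor X' g Y') =
      mor (fib_prod X X') (\<lambda>z. pair Y Y' (f (prj0 X X' z)) (g (prj1 X X' z))) (fib_prod Y Y')"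
    and "colour_map (fib_prod X X') (fib_prod Y Y')
      (\<lambda>z. pair Y Y' (f (prj0 X X' z)) (g (prj1 X X' z)))"
  unfolding times_arr_def
  using chosen_cone_mor[OF obj(1,3)] obj f g
  by (auto simp: Comp_mor tuple_mor colour_map_comp)

section \<open>Partial morphisms are coloured partial functions\<close>

definition span_graph ::
  "(('u set \<times> 'u setarr) \<times> 'u setarr \<times> ('u set \<times> 'u setarr)) \<times>
   (('u set \<times> 'u setarr) \<times> 'u setarr \<times> ('u set \<times> 'u setarr)) \<Rightarrow> ('u \<times> 'u) set" where
  "span_graph = (\<lambda>(m, f). (\<lambda>u. (apply_arr m u, apply_arr f u)) ` fst (Dom K m))"

definition pgraphs :: "'u set \<times> 'u setarr \<Rightarrow> 'u set \<times> 'u setarr \<Rightarrow> ('u \<times> 'u) set set" where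
  "pgraphs X Y = {G. single_valued G \<and>
     (\<forall>(x, y) \<in> G. x \<in> fst X \<and> y \<in> fst Y \<and> colour Y y = colour X x)}"

text \<open>The partial morphism with graph \<open>G\<close>: its equivalence class consists of all spans with this graph.\<close>

definition pmor where
  "pmor X G Y = (X, {s \<in> spans K X Y. span_graph s = G}, Y)"

text \<open>This removes the categorical wrapping from spans: the left leg is an injective function.\<close>

lemma spans_K:
  assumes "X \<in> Obj K" "Y \<in> Obj K"
  shows "s \<in> spans K X Y \<longleftrightarrow> (\<exists>U m f. U \<in> Obj K \<and> s = (mor U m X, mor U f Y) \<and>
    colour_map U X m \<and> inj_on m (fst U) \<and> colour_map U Y f)"
proof
  assume s: "s \<in> spans K X Y"
  obtain n g where sn: "s = (n, g)" by (cases s)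
  have n: "n \<in> Arr K" "mono_arr K n" and g: "g \<in> Arr K"
    and eq: "fst n = fst g" "snd (snd n) = X" "snd (snd g) = Y"
    using s by (auto simp: sn spans_def mono_arr_def)
  have "n = mor (fst n) (apply_arr n) X" "g = mor (fst n) (apply_arr g) Y"
    using ArrD(3)[OF n(1)] ArrD(3)[OF g] eq by auto
  moreover have "inj_on (apply_arr n) (fst (fst n))"
    using mono_iff_inj[of "fst n" X "apply_arr n"] ArrD[OF n(1)] n(2) eq by auto
  ultimately show "\<exists>U m f. U \<in> Obj K \<and> s = (mor U m X, mor U f Y) \<and>
    colour_map U X m \<and> inj_on m (fst U) \<and> colour_map U Y f"
    using ArrD[OF n(1)] ArrD[OF g] eq sn by metis
next
  assume "\<exists>U m f. U \<in> Obj K \<and> s = (mor U m X, mor U f Y) \<and>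
    colour_map U X m \<and> inj_on m (fst U) \<and> colour_map U Y f"
  then show "s \<in> spans K X Y"
    using assms by (auto simp: spans_def mono_iff_inj intro: mor_in_Arr)
qed

lemma span_graph_mor: "span_graph (mor U m X, mor U f Y) = (\<lambda>u. (m u, f u)) ` fst U"
  by (auto simp: span_graph_def)

lemma span_graph_pgraph:
  assumes "X \<in> Obj K" "Y \<in> Obj K" "s \<in> spans K X Y"
  shows "span_graph s \<in> pgraphs X Y"
proof -
  obtain U m f where s: "s = (mor U m X, mor U f Y)" and f: "colour_map U X m" "inj_on m (fst U)"
    "colour_map U Y f"
    using assms spans_K by blast
  have "(\<lambda>u. (m u, f u)) ` fst U \<in> pgraphs X Y"
    using f by (auto simp: pgraphs_def single_valued_def colour_map_def inj_on_def)
  then show ?thesis by (simp add: s span_graph_mor)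
qed

lemma iso_bij:
  assumes "X \<in> Obj K" "Y \<in> Obj K" "colour_map X Y f" "bij_betw f (fst X) (fst Y)"
  shows "iso_arr K (mor X f Y)"
proof -
  let ?g = "inv_into (fst X) f"
  have g: "colour_map Y X ?g"
    using assms(3,4) unfolding colour_map_def bij_betw_def
    by (metis f_inv_into_f inv_into_into)
  show ?thesis
    unfolding iso_arr_def
    using assms g
    by (auto intro!: mor_in_Arr bexI[of _ "mor Y ?g X"]
        simp: Comp_mor Idn_K mor_eq_iff hom_K bij_betw_inv_into_left bij_betw_inv_into_right)
qed

text \<open>If the graphs agree, each \<open>u\<close> has a partner \<open>v\<close> with the same image under both legs, unique since
  the left leg is injective, and matching \<open>u\<close> with \<open>v\<close> is the required isomorphism.\<close>

lemma span_rel_iff: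
  assumes X: "X \<in> Obj K" and Y: "Y \<in> Obj K" and s: "s \<in> spans K X Y" and t: "t \<in> spans K X Y"
  shows "(s, t) \<in> span_rel K X Y \<longleftrightarrow> span_graph s = span_graph t"
proof -
  obtain U m f where s': "s = (mor U m X, mor U f Y)" "U \<in> Obj K" "colour_map U X m"
      "inj_on m (fst U)" "colour_map U Y f"
    using s spans_K[OF X Y] by blast
  obtain V n g where t': "t = (mor V n X, mor V g Y)" "V \<in> Obj K" "colour_map V X n"
      "inj_on n (fst V)" "colour_map V Y g"
    using t spans_K[OF X Y] by blast
  show ?thesis
  proof
    assume "(s, t) \<in> span_rel K X Y"
    then obtain \<theta> where th: "\<theta> \<in> hom K U V" "iso_arr K \<theta>"
      "mor U m X = mor V n X \<cdot>\<^bsub>K\<^esub> \<theta>" "mor U f Y = mor V g Y \<cdot>\<^bsub>K\<^esub> \<theta>"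
      by (auto simp: span_rel_def s' t')
    obtain h where h: "colour_map U V h" "\<theta> = mor U h V"
      using th(1) s' t' by (auto simp: hom_K)
    obtain k where k: "colour_map V U k" "mor U h V \<cdot>\<^bsub>K\<^esub> mor V k U = mor V (\<lambda>x. x) V"
      using th(2) s' t' by (auto simp: iso_arr_def hom_K h(2) Idn_K)
    have hk: "\<And>v. v \<in> fst V \<Longrightarrow> h (k v) = v" "\<And>u. u \<in> fst U \<Longrightarrow> m u = n (h u)"
      "\<And>u. u \<in> fst U \<Longrightarrow> f u = g (h u)"
      using k th(3,4) h by (auto simp: Comp_mor mor_eq_iff)
    have "(m u, f u) \<in> (\<lambda>v. (n v, g v)) ` fst V" if "u \<in> fst U" for u
      using that hk h(1) by (auto simp: colour_map_def)
    moreover have "(n v, g v) \<in> (\<lambda>u. (m u, f u)) ` fst U" if "v \<in> fst V" for v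
      using that hk k(1) by (auto simp: colour_map_def intro!: image_eqI[of _ _ "k v"])
    ultimately show "span_graph s = span_graph t"
      unfolding s' t' span_graph_mor by blast
  next
    assume "span_graph s = span_graph t"
    then have eq: "(\<lambda>u. (m u, f u)) ` fst U = (\<lambda>v. (n v, g v)) ` fst V"
      by (simp add: s' t' span_graph_mor)
    have "\<forall>u\<in>fst U. \<exists>v\<in>fst V. m u = n v \<and> f u = g v"
      using eq by (auto simp: set_eq_iff image_iff)
    then obtain h where h: "\<And>u. u \<in> fst U \<Longrightarrow> h u \<in> fst V \<and> m u = n (h u) \<and> f u = g (h u)"
      by metis
    have cm: "colour_map U V h"
      using h s'(3) t'(3) by (auto simp: colour_map_def)
    have inj: "inj_on h (fst U)"
      using h s'(4) by (auto simp: inj_on_def)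
    have "v \<in> h ` fst U" if v: "v \<in> fst V" for v
    proof -
      have "(n v, g v) \<in> (\<lambda>u. (m u, f u)) ` fst U" using v unfolding eq by blast
      then obtain u where u: "u \<in> fst U" "m u = n v" by auto
      then have "h u = v" using h[OF u(1)] t'(4) v by (auto simp: inj_on_def)
      then show ?thesis using u by blast
    qed
    then have "iso_arr K (mor U h V)"
      using cm inj s' t' h by (intro iso_bij) (auto simp: bij_betw_def)
    then show "(s, t) \<in> span_rel K X Y"
      using s t cm h s' t'
      by (auto simp: span_rel_def hom_K Comp_mor mor_eq_iff intro!: bexI[of _ "mor U h V"])
  qed
qed

lemma span_class_eq:
  assumes X: "X \<in> Obj K" and Y: "Y \<in> Obj K" and s: "(m, f) \<in> spans K X Y"
  shows "span_class K m f = {t \<in> spans K X Y. span_graph t = span_graph (m, f)}"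
proof -
  have "Cod K m = X" "Cod K f = Y" using s by (auto simp: spans_def)
  moreover have "t \<in> spans K X Y" if "(s, t) \<in> span_rel K X Y" for s t
    using that by (auto simp: span_rel_def)
  ultimately have "span_class K m f = {t. t \<in> spans K X Y \<and> ((m, f), t) \<in> span_rel K X Y}"
    unfolding span_class_def by blast
  then show ?thesis
    using span_rel_iff[OF X Y s] by (simp add: eq_commute cong: conj_cong)
qed

text \<open>The span is carried by the domain of \<open>G\<close>, with the inclusion as left leg.\<close>

lemma span_of_graph:
  assumes X: "X \<in> Obj K" and Y: "Y \<in> Obj K" and G: "G \<in> pgraphs X Y"
  shows "\<exists>s \<in> spans K X Y. span_graph s = G"
proof -
  define f where "f x = (THE y. (x, y) \<in> G)" for x
  have f: "f x = y" if "(x, y) \<in> G" for x y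
    using that G unfolding f_def pgraphs_def single_valued_def by blast
  let ?U = "sub X (Domain G)"
  have sub: "Domain G \<subseteq> fst X" using G by (auto simp: pgraphs_def)
  have f_colour: "f x \<in> fst Y \<and> colour Y (f x) = colour X x" if x: "x \<in> Domain G" for x
  proof -
    obtain y where y: "(x, y) \<in> G" using x by blast
    then show ?thesis using G f[OF y] by (auto simp: pgraphs_def)
  qed
  have "colour_map ?U X (\<lambda>x. x)" "colour_map ?U Y f" "inj_on (\<lambda>x. x) (fst ?U)"
    using sub f_colour by (auto simp: colour_map_def)
  then have "(mor ?U (\<lambda>x. x) X, mor ?U f Y) \<in> spans K X Y"
    unfolding spans_K[OF X Y] using sub_in_Obj[OF X sub] by blast
  moreover have "span_graph (mor ?U (\<lambda>x. x) X, mor ?U f Y) = G"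
    unfolding span_graph_mor by (auto simp: image_iff f intro: f[symmetric])
  ultimately show ?thesis by blast
qed

lemma pmor_inj:
  assumes "X \<in> Obj K" "Y \<in> Obj K" "G \<in> pgraphs X Y"
    "pmor X G Y = pmor X H Y"
  shows "G = H"
  using span_of_graph[OF assms(1-3)] assms(4) by (auto simp: pmor_def)

lemma Arr_Pfn:
  "f \<in> Arr (Pfn K) \<longleftrightarrow> (\<exists>X\<in>Obj K. \<exists>Y\<in>Obj K. \<exists>G\<in>pgraphs X Y. f = pmor X G Y)"
proof -
  have classes: "c \<in> spans K X Y // span_rel K X Y \<longleftrightarrow>
      (\<exists>G\<in>pgraphs X Y. c = {s \<in> spans K X Y. span_graph s = G})"
    if X: "X \<in> Obj K" and Y: "Y \<in> Obj K" for X Y c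
  proof -
    have class_eq: "span_rel K X Y `` {s} = {t \<in> spans K X Y. span_graph t = span_graph s}"
      if "s \<in> spans K X Y" for s
    proof -
      have "t \<in> spans K X Y" if "(s, t) \<in> span_rel K X Y" for t
        using that by (auto simp: span_rel_def)
      then have "span_rel K X Y `` {s} = {t. t \<in> spans K X Y \<and> (s, t) \<in> span_rel K X Y}"
        by blast
      then show ?thesis
        using span_rel_iff[OF X Y that] by (simp add: eq_commute cong: conj_cong)
    qed
    show ?thesis
    proof
      assume "c \<in> spans K X Y // span_rel K X Y"
      then obtain s where s: "s \<in> spans K X Y" "c = span_rel K X Y `` {s}"
        by (rule quotientE)
      show "\<exists>G\<in>pgraphs X Y. c = {s \<in> spans K X Y. span_graph s = G}"
        using span_graph_pgraph[OF X Y s(1)] unfolding s(2) class_eq[OF s(1)] by blast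
    next
      assume "\<exists>G\<in>pgraphs X Y. c = {s \<in> spans K X Y. span_graph s = G}"
      then obtain G where G: "G \<in> pgraphs X Y" "c = {s \<in> spans K X Y. span_graph s = G}"
        by blast
      obtain s where s: "s \<in> spans K X Y" "span_graph s = G"
        using span_of_graph[OF X Y G(1)] by blast
      have "c = span_rel K X Y `` {s}"
        unfolding G(2) class_eq[OF s(1)] s(2) ..
      then show "c \<in> spans K X Y // span_rel K X Y"
        using s(1) by (auto intro: quotientI)
    qed
  qed
  obtain X c Y where f: "f = (X, c, Y)" using prod_cases3 by blast
  have arr: "f \<in> Arr (Pfn K) \<longleftrightarrow> X \<in> Obj K \<and> Y \<in> Obj K \<and> c \<in> spans K X Y // span_rel K X Y"
    unfolding f Pfn_def by simp
  show ?thesis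
  proof
    assume "f \<in> Arr (Pfn K)"
    then have XY: "X \<in> Obj K" "Y \<in> Obj K" "c \<in> spans K X Y // span_rel K X Y"
      unfolding arr by auto
    then obtain G where "G \<in> pgraphs X Y" "f = pmor X G Y"
      unfolding classes[OF XY(1,2)] f pmor_def by blast
    then show "\<exists>X\<in>Obj K. \<exists>Y\<in>Obj K. \<exists>G\<in>pgraphs X Y. f = pmor X G Y"
      using XY(1,2) by blast
  next
    assume "\<exists>X\<in>Obj K. \<exists>Y\<in>Obj K. \<exists>G\<in>pgraphs X Y. f = pmor X G Y"
    then obtain X' Y' G where G: "X' \<in> Obj K" "Y' \<in> Obj K" "G \<in> pgraphs X' Y'" "f = pmor X' G Y'"
      by blast
    then have "X' = X" "Y' = Y" "c = {s \<in> spans K X Y. span_graph s = G}"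
      unfolding f pmor_def by auto
    then show "f \<in> Arr (Pfn K)"
      unfolding arr using G classes by blast
  qed
qed


text \<open>As for products, a point of the pullback is a pair of points with a common image; here the
  argument applies to an arbitrary pullback, since composition refers to all of them.\<close>

lemma pullback_points:
  assumes obj: "U \<in> Obj K" "V \<in> Obj K" "W \<in> Obj K" "Y \<in> Obj K"
    and f: "colour_map U Y f" and n: "colour_map V Y n"
    and a: "colour_map W U a" and b: "colour_map W V b"
    and pb: "pullback K (mor U f Y) (mor V n Y) (mor W a U) (mor W b V)"
    and u: "u \<in> fst U" and v: "v \<in> fst V" and uv: "f u = n v"
  shows "\<exists>!w. w \<in> fst W \<and> a w = u \<and> b w = v"
proof -
  let ?T = "sub U {u}"
  have T: "?T \<in> Obj K" using obj u by (auto intro!: sub_in_Obj)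
  have c: "colour V v = colour U u" using f n u v uv by (metis colour_map_def)
  have pu: "colour_map ?T U (\<lambda>_. u)" and pv: "colour_map ?T V (\<lambda>_. v)"
    using obj u v c by (auto intro!: point_map)
  have "commuting_square K (mor U f Y) (mor V n Y) (mor ?T (\<lambda>_. u) U) (mor ?T (\<lambda>_. v) V)"
    using obj f n T pu pv uv by (auto simp: commuting_square_def Comp_mor intro!: mor_in_Arr)
  then have "\<exists>!h. h \<in> hom K (Dom K (mor ?T (\<lambda>_. u) U)) (Dom K (mor W a U)) \<and>
      mor W a U \<cdot>\<^bsub>K\<^esub> h = mor ?T (\<lambda>_. u) U \<and> mor W b V \<cdot>\<^bsub>K\<^esub> h = mor ?T (\<lambda>_. v) V"
    by (rule conjunct2[OF pb[unfolded pullback_def], rule_format])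
  then have ex1: "\<exists>!h. h \<in> hom K ?T W \<and> mor W a U \<cdot>\<^bsub>K\<^esub> h = mor ?T (\<lambda>_. u) U \<and>
      mor W b V \<cdot>\<^bsub>K\<^esub> h = mor ?T (\<lambda>_. v) V"
    by simp
  have point: "mor ?T (\<lambda>_. w) W \<in> hom K ?T W \<and>
      mor W a U \<cdot>\<^bsub>K\<^esub> mor ?T (\<lambda>_. w) W = mor ?T (\<lambda>_. u) U \<and>
      mor W b V \<cdot>\<^bsub>K\<^esub> mor ?T (\<lambda>_. w) W = mor ?T (\<lambda>_. v) V"
    if w: "w \<in> fst W" "a w = u" "b w = v" for w
  proof -
    have "colour_map ?T W (\<lambda>_. w)"
      using w a obj u by (intro point_map) (auto simp: colour_map_def)
    then show ?thesis using T obj w by (auto simp: hom_K Comp_mor)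
  qed
  show ?thesis
  proof (rule ex_ex1I)
    obtain h where h: "colour_map ?T W h"
      "mor W a U \<cdot>\<^bsub>K\<^esub> mor ?T h W = mor ?T (\<lambda>_. u) U"
      "mor W b V \<cdot>\<^bsub>K\<^esub> mor ?T h W = mor ?T (\<lambda>_. v) V"
      using ex1_implies_ex[OF ex1] unfolding hom_K[OF T obj(3)] by blast
    then show "\<exists>w. w \<in> fst W \<and> a w = u \<and> b w = v"
      by (intro exI[of _ "h u"]) (auto simp: Comp_mor mor_eq_iff colour_map_def)
  next
    fix w w' assume "w \<in> fst W \<and> a w = u \<and> b w = v" "w' \<in> fst W \<and> a w' = u \<and> b w' = v"
    then have "mor ?T (\<lambda>_. w) W = mor ?T (\<lambda>_. w') W"
      using ex1 point by blast
    then show "w = w'" by (simp add: mor_eq_iff)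
  qed
qed

text \<open>The preimage of the subobject is a pullback. Existence matters because the composite of two
  classes is a union over all pullbacks, which would be empty otherwise.\<close>

lemma pullback_of_mono_exists:
  assumes obj: "U \<in> Obj K" "V \<in> Obj K" "Y \<in> Obj K"
    and f: "colour_map U Y f" and n: "colour_map V Y n" and inj: "inj_on n (fst V)"
  shows "\<exists>q r. pullback K (mor U f Y) (mor V n Y) q r"
proof -
  let ?W = "sub U {u \<in> fst U. f u \<in> n ` fst V}"
  let ?r = "\<lambda>u. inv_into (fst V) n (f u)"
  have W: "?W \<in> Obj K" using obj by (auto intro!: sub_in_Obj)
  have q: "colour_map ?W U (\<lambda>u. u)" by (auto simp: colour_map_def)
  have nr: "n (?r u) = f u" "?r u \<in> fst V" if "u \<in> fst ?W" for u
    using that by (auto simp: f_inv_into_f inv_into_into)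
  have r: "colour_map ?W V ?r"
    unfolding colour_map_def
  proof (intro ballI conjI)
    fix u assume u: "u \<in> fst ?W"
    show "?r u \<in> fst V" using nr[OF u] by simp
    show "colour V (?r u) = colour ?W u"
      using colour_mapD[OF n nr(2)[OF u]] colour_mapD[OF f, of u] nr(1)[OF u] u by simp
  qed
  have "pullback K (mor U f Y) (mor V n Y) (mor ?W (\<lambda>u. u) U) (mor ?W ?r V)"
    unfolding pullback_def
  proof (intro conjI allI impI)
    show "commuting_square K (mor U f Y) (mor V n Y) (mor ?W (\<lambda>u. u) U) (mor ?W ?r V)"
      using obj W q r f n nr
      by (auto simp: commuting_square_def Comp_mor mor_eq_iff intro!: mor_in_Arr simp del: sub_simps)
  next
    fix q' r' assume sq: "commuting_square K (mor U f Y) (mor V n Y) q' r'"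
    define T where "T = fst q'"
    have "q' \<in> Arr K" "r' \<in> Arr K" "snd (snd q') = U" "snd (snd r') = V" "fst r' = T"
      using sq by (auto simp: commuting_square_def T_def)
    then obtain a b where a: "q' = mor T a U" "colour_map T U a"
      and b: "r' = mor T b V" "colour_map T V b" and T: "T \<in> Obj K"
      using ArrD[of q'] ArrD[of r'] T_def by metis
    have eq: "f (a t) = n (b t)" if "t \<in> fst T" for t
      using sq that by (auto simp: commuting_square_def a b Comp_mor mor_eq_iff)
    have aW: "colour_map T ?W a"
      using a(2) b(2) eq by (auto simp: colour_map_def)
    have rb: "?r (a t) = b t" if "t \<in> fst T" for t
      using that eq[OF that] b(2) inj by (simp add: colour_map_def)
    show "\<exists>!h. h \<in> hom K (Dom K q') (Dom K (mor ?W (\<lambda>u. u) U)) \<and>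
        mor ?W (\<lambda>u. u) U \<cdot>\<^bsub>K\<^esub> h = q' \<and> mor ?W ?r V \<cdot>\<^bsub>K\<^esub> h = r'"
    proof (rule ex1I[of _ "mor T a ?W"])
      have "mor T a ?W \<in> hom K T ?W" using aW hom_K[OF T W] by blast
      then show "mor T a ?W \<in> hom K (Dom K q') (Dom K (mor ?W (\<lambda>u. u) U)) \<and>
        mor ?W (\<lambda>u. u) U \<cdot>\<^bsub>K\<^esub> mor T a ?W = q' \<and> mor ?W ?r V \<cdot>\<^bsub>K\<^esub> mor T a ?W = r'"
        using rb unfolding Comp_mor[OF aW] by (simp add: a b mor_eq_iff)
    next
      fix h assume h: "h \<in> hom K (Dom K q') (Dom K (mor ?W (\<lambda>u. u) U)) \<and>
        mor ?W (\<lambda>u. u) U \<cdot>\<^bsub>K\<^esub> h = q' \<and> mor ?W ?r V \<cdot>\<^bsub>K\<^esub> h = r'"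
      then have "h \<in> hom K T ?W" by (simp add: a)
      then obtain h' where h': "h = mor T h' ?W" "colour_map T ?W h'"
        unfolding hom_K[OF T W] by blast
      then show "h = mor T a ?W"
        using h by (simp add: a Comp_mor[OF h'(2)] mor_eq_iff)
    qed
  qed
  then show ?thesis by blast
qed

text \<open>An element of the pullback is a pair \<open>(u, v)\<close> for which the right leg of the first span and the
  left leg of the second meet, which is a witness for the composite relation.\<close>

lemma span_graph_comp:
  assumes obj: "X \<in> Obj K" "Y \<in> Obj K" "Z \<in> Obj K"
    and s: "(m, f) \<in> spans K X Y" and t: "(m', f') \<in> spans K Y Z"
    and pb: "pullback K f m' q r"
  shows "(m \<cdot>\<^bsub>K\<^esub> q, f' \<cdot>\<^bsub>K\<^esub> r) \<in> spans K X Z"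
    and "span_graph (m \<cdot>\<^bsub>K\<^esub> q, f' \<cdot>\<^bsub>K\<^esub> r) = span_graph (m, f) O span_graph (m', f')"
proof -
  obtain U k g where s': "m = mor U k X" "f = mor U g Y" "U \<in> Obj K" "colour_map U X k"
      "inj_on k (fst U)" "colour_map U Y g"
    using s spans_K[OF obj(1,2)] by blast
  obtain V n l where t': "m' = mor V n Y" "f' = mor V l Z" "V \<in> Obj K" "colour_map V Y n"
      "inj_on n (fst V)" "colour_map V Z l"
    using t spans_K[OF obj(2,3)] by blast
  define W where "W = fst q"
  have sq: "commuting_square K (mor U g Y) (mor V n Y) q r"
    using pb unfolding pullback_def s' t' by blast
  then have "q \<in> Arr K" "r \<in> Arr K" "snd (snd q) = U" "snd (snd r) = V" "fst r = W"
    by (auto simp: commuting_square_def W_def)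
  then obtain a b where a: "q = mor W a U" "colour_map W U a"
      and b: "r = mor W b V" "colour_map W V b" and W: "W \<in> Obj K"
    using ArrD[of q] ArrD[of r] W_def by metis
  have eq: "g (a w) = n (b w)" if "w \<in> fst W" for w
    using sq that by (auto simp: commuting_square_def a b Comp_mor mor_eq_iff)
  have points: "\<exists>!w. w \<in> fst W \<and> a w = u \<and> b w = v" if "u \<in> fst U" "v \<in> fst V" "g u = n v" for u v
    using pullback_points[OF s'(3) t'(3) W obj(2) s'(6) t'(4) a(2) b(2) _ that] pb
    unfolding s' t' a b by blast
  have ab: "a w \<in> fst U" "b w \<in> fst V" if "w \<in> fst W" for w
    using a(2) b(2) that by (auto simp: colour_map_def)
  have "inj_on (\<lambda>w. k (a w)) (fst W)"
  proof (rule inj_onI)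
    fix w w' assume w: "w \<in> fst W" "w' \<in> fst W" "k (a w) = k (a w')"
    have "a w = a w'" using s'(5) w ab by (auto simp: inj_on_def)
    moreover from this have "b w = b w'"
      using eq[OF w(1)] eq[OF w(2)] t'(5) w ab by (auto simp: inj_on_def)
    ultimately show "w = w'"
      using points[OF ab(1)[OF w(1)] ab(2)[OF w(1)] eq[OF w(1)]] w by auto
  qed
  moreover have comp: "m \<cdot>\<^bsub>K\<^esub> q = mor W (\<lambda>w. k (a w)) X" "f' \<cdot>\<^bsub>K\<^esub> r = mor W (\<lambda>w. l (b w)) Z"
    unfolding s' t' a b Comp_mor[OF a(2)] Comp_mor[OF b(2)] by auto
  ultimately show "(m \<cdot>\<^bsub>K\<^esub> q, f' \<cdot>\<^bsub>K\<^esub> r) \<in> spans K X Z"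
    using W colour_map_comp[OF a(2) s'(4)] colour_map_comp[OF b(2) t'(6)]
    unfolding spans_K[OF obj(1,3)] by blast
  show "span_graph (m \<cdot>\<^bsub>K\<^esub> q, f' \<cdot>\<^bsub>K\<^esub> r) = span_graph (m, f) O span_graph (m', f')"
    unfolding comp unfolding s' t' span_graph_mor
  proof (intro subset_antisym subsetI)
    fix p assume "p \<in> (\<lambda>w. (k (a w), l (b w))) ` fst W"
    then obtain w where w: "w \<in> fst W" "p = (k (a w), l (b w))" by blast
    then show "p \<in> (\<lambda>u. (k u, g u)) ` fst U O (\<lambda>v. (n v, l v)) ` fst V"
      using ab[OF w(1)] eq[OF w(1)] by auto
  next
    fix p assume "p \<in> (\<lambda>u. (k u, g u)) ` fst U O (\<lambda>v. (n v, l v)) ` fst V"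
    then obtain u v where uv: "u \<in> fst U" "v \<in> fst V" "g u = n v" "p = (k u, l v)" by auto
    obtain w where "w \<in> fst W" "a w = u" "b w = v" using points[OF uv(1-3)] by blast
    then show "p \<in> (\<lambda>w. (k (a w), l (b w))) ` fst W" using uv(4) by auto
  qed
qed

text \<open>All representatives and all pullbacks give spans with the same graph, so the union that defines
  the composite is the union of a nonempty family of equal classes.\<close>

lemma parr_comp_pmor:
  assumes obj: "X \<in> Obj K" "Y \<in> Obj K" "Z \<in> Obj K"
    and G: "G \<in> pgraphs X Y" and H: "H \<in> pgraphs Y Z"
  shows "parr_comp K (pmor Y H Z) (pmor X G Y) = pmor X (G O H) Z"
proof -
  let ?cl = "\<lambda>X Y G. {s \<in> spans K X Y. span_graph s = G}"
  let ?C = "{span_class K (m \<cdot>\<^bsub>K\<^esub> q) (f' \<cdot>\<^bsub>K\<^esub> r) | m f m' f' q r.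
      (m, f) \<in> ?cl X Y G \<and> (m', f') \<in> ?cl Y Z H \<and> pullback K f m' q r}"
  have "c = ?cl X Z (G O H)" if rep: "c \<in> ?C" for c
  proof -
    obtain m f m' f' q r where c: "c = span_class K (m \<cdot>\<^bsub>K\<^esub> q) (f' \<cdot>\<^bsub>K\<^esub> r)"
      and s: "(m, f) \<in> spans K X Y" "span_graph (m, f) = G"
      and t: "(m', f') \<in> spans K Y Z" "span_graph (m', f') = H" and pb: "pullback K f m' q r"
      using rep by blast
    show ?thesis
      unfolding c span_class_eq[OF obj(1,3) span_graph_comp(1)[OF obj s(1) t(1) pb]]
        span_graph_comp(2)[OF obj s(1) t(1) pb] s(2) t(2) ..
  qed
  moreover have "?C \<noteq> {}"
  proof -
    obtain s where s: "s \<in> spans K X Y" "span_graph s = G"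
      using span_of_graph[OF obj(1,2) G] by blast
    obtain t where t: "t \<in> spans K Y Z" "span_graph t = H"
      using span_of_graph[OF obj(2,3) H] by blast
    obtain U k g where s': "s = (mor U k X, mor U g Y)" "U \<in> Obj K" "colour_map U Y g"
      using s spans_K[OF obj(1,2)] by blast
    obtain V n l where t': "t = (mor V n Y, mor V l Z)" "V \<in> Obj K" "colour_map V Y n"
        "inj_on n (fst V)"
      using t spans_K[OF obj(2,3)] by blast
    obtain q r where "pullback K (mor U g Y) (mor V n Y) q r"
      using pullback_of_mono_exists[OF s'(2) t'(2) obj(2) s'(3) t'(3,4)] by blast
    then show ?thesis using s t s'(1) t'(1) by blast
  qed
  ultimately have "\<Union>?C = ?cl X Z (G O H)" by blast
  then show ?thesis by (simp add: parr_comp_def pmor_def)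
qed

definition box_graph where
  "box_graph X X' Y Y' G G' = {(z, w). z \<in> fst (fib_prod X X') \<and> w \<in> fst (fib_prod Y Y') \<and>
     (prj0 X X' z, prj0 Y Y' w) \<in> G \<and> (prj1 X X' z, prj1 Y Y' w) \<in> G'}"

text \<open>A point of \<open>U \<times> V\<close> is a pair of points of one colour. Conversely, if \<open>z\<close> projects to the images of \<open>u\<close>
  and \<open>v\<close>, then \<open>u\<close> and \<open>v\<close> both have the colour of \<open>z\<close> and form a pair.\<close>

lemma span_graph_times:
  assumes obj: "X \<in> Obj K" "Y \<in> Obj K" "X' \<in> Obj K" "Y' \<in> Obj K"
    and s: "(m, f) \<in> spans K X Y" and t: "(m', f') \<in> spans K X' Y'"
  shows "(times_arr K m m', times_arr K f f') \<in> spans K (fib_prod X X') (fib_prod Y Y')"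
    and "span_graph (times_arr K m m', times_arr K f f') =
      box_graph X X' Y Y' (span_graph (m, f)) (span_graph (m', f'))"
proof -
  obtain U k g where s': "m = mor U k X" "f = mor U g Y" "U \<in> Obj K" "colour_map U X k"
      "inj_on k (fst U)" "colour_map U Y g"
    using s spans_K[OF obj(1,2)] by blast
  obtain V n l where t': "m' = mor V n X'" "f' = mor V l Y'" "V \<in> Obj K" "colour_map V X' n"
      "inj_on n (fst V)" "colour_map V Y' l"
    using t spans_K[OF obj(3,4)] by blast
  let ?a = "\<lambda>z. pair X X' (k (prj0 U V z)) (n (prj1 U V z))"
  let ?b = "\<lambda>z. pair Y Y' (g (prj0 U V z)) (l (prj1 U V z))"
  note T = times_mor[OF s'(3) obj(1) t'(3) obj(3) s'(4) t'(4)]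
    times_mor[OF s'(3) obj(2) t'(3) obj(4) s'(6) t'(6)]
  have k: "k u \<in> fst X" "colour X (k u) = colour U u"
      "g u \<in> fst Y" "colour Y (g u) = colour U u" if "u \<in> fst U" for u
    using that s' by (auto simp: colour_map_def)
  have n: "n v \<in> fst X'" "colour X' (n v) = colour V v"
      "l v \<in> fst Y'" "colour Y' (l v) = colour V v" if "v \<in> fst V" for v
    using that t' by (auto simp: colour_map_def)
  have a_prj: "prj0 X X' (?a z) = k (prj0 U V z)" "prj1 X X' (?a z) = n (prj1 U V z)"
    if "z \<in> fst (fib_prod U V)" for z
    using prj_in[OF s'(3) t'(3) that] obj by (simp_all add: k n)
  have "inj_on ?a (fst (fib_prod U V))"
  proof (rule inj_onI)
    fix z z' assume z: "z \<in> fst (fib_prod U V)" and z': "z' \<in> fst (fib_prod U V)" and eq: "?a z = ?a z'"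
    note in_z = prj_in[OF s'(3) t'(3) z] and in_z' = prj_in[OF s'(3) t'(3) z']
    have "k (prj0 U V z) = k (prj0 U V z')" "n (prj1 U V z) = n (prj1 U V z')"
      using a_prj[OF z] a_prj[OF z'] eq by simp_all
    then have "prj0 U V z = prj0 U V z'" "prj1 U V z = prj1 U V z'"
      using s'(5) t'(5) in_z in_z' by (auto simp: inj_on_def)
    then show "z = z'" using times_eqI[OF s'(3) t'(3) z z'] by simp
  qed
  then show "(times_arr K m m', times_arr K f f') \<in> spans K (fib_prod X X') (fib_prod Y Y')"
    unfolding s'(1,2) t'(1,2) T(1,3) spans_K[OF times_Obj[OF obj(1,3)] times_Obj[OF obj(2,4)]]
    using times_Obj[OF s'(3) t'(3)] T(2,4) by blast
  show "span_graph (times_arr K m m', times_arr K f f') =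
      box_graph X X' Y Y' (span_graph (m, f)) (span_graph (m', f'))"
    unfolding s'(1,2) t'(1,2) T(1,3) span_graph_mor
  proof (intro subset_antisym subsetI)
    fix p assume "p \<in> (\<lambda>z. (?a z, ?b z)) ` fst (fib_prod U V)"
    then obtain z where z: "z \<in> fst (fib_prod U V)" "p = (?a z, ?b z)" by blast
    note in_z = prj_in[OF s'(3) t'(3) z(1)]
    show "p \<in> box_graph X X' Y Y' ((\<lambda>u. (k u, g u)) ` fst U) ((\<lambda>v. (n v, l v)) ` fst V)"
      using in_z obj by (simp add: z(2) box_graph_def k n)
  next
    fix p assume "p \<in> box_graph X X' Y Y' ((\<lambda>u. (k u, g u)) ` fst U) ((\<lambda>v. (n v, l v)) ` fst V)"
    then obtain z w u v where p: "p = (z, w)" "z \<in> fst (fib_prod X X')" "w \<in> fst (fib_prod Y Y')"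
      and u: "u \<in> fst U" "prj0 X X' z = k u" "prj0 Y Y' w = g u"
      and v: "v \<in> fst V" "prj1 X X' z = n v" "prj1 Y Y' w = l v"
      by (auto simp: box_graph_def)
    have c: "colour U u = colour V v"
      using k(2)[OF u(1)] n(2)[OF v(1)] prj_in(3,4)[OF obj(1,3) p(2)] u(2) v(2) by simp
    have "?a (pair U V u v) = z" "?b (pair U V u v) = w"
      using u v c s'(3) t'(3) pair_prj[OF obj(1,3) p(2)] pair_prj[OF obj(2,4) p(3)] by simp_all
    then show "p \<in> (\<lambda>z. (?a z, ?b z)) ` fst (fib_prod U V)"
      using pair_in(1)[OF s'(3) t'(3) u(1) v(1) c] p(1) by force
  qed
qed

lemma parr_box_pmor:
  assumes obj: "X \<in> Obj K" "Y \<in> Obj K" "X' \<in> Obj K" "Y' \<in> Obj K"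
    and G: "G \<in> pgraphs X Y" and H: "H \<in> pgraphs X' Y'"
  shows "parr_box K (pmor X G Y) (pmor X' H Y') =
    pmor (fib_prod X X') (box_graph X X' Y Y' G H) (fib_prod Y Y')"
proof -
  let ?cl = "\<lambda>X Y G. {s \<in> spans K X Y. span_graph s = G}"
  let ?C = "{span_class K (times_arr K m m') (times_arr K f f') | m f m' f'.
      (m, f) \<in> ?cl X Y G \<and> (m', f') \<in> ?cl X' Y' H}"
  have "c = ?cl (fib_prod X X') (fib_prod Y Y') (box_graph X X' Y Y' G H)" if rep: "c \<in> ?C" for c
  proof -
    obtain m f m' f' where c: "c = span_class K (times_arr K m m') (times_arr K f f')"
      and s: "(m, f) \<in> spans K X Y" "span_graph (m, f) = G"
      and t: "(m', f') \<in> spans K X' Y'" "span_graph (m', f') = H"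
      using rep by blast
    show ?thesis
      unfolding c span_class_eq[OF times_Obj[OF obj(1,3)] times_Obj[OF obj(2,4)]
          span_graph_times(1)[OF obj s(1) t(1)]]
        span_graph_times(2)[OF obj s(1) t(1)] s(2) t(2) ..
  qed
  moreover have "?C \<noteq> {}"
  proof -
    obtain m f where s: "(m, f) \<in> spans K X Y" "span_graph (m, f) = G"
      using span_of_graph[OF obj(1,2) G] by auto
    obtain m' f' where t: "(m', f') \<in> spans K X' Y'" "span_graph (m', f') = H"
      using span_of_graph[OF obj(3,4) H] by auto
    show ?thesis using s t by blast
  qed
  ultimately have "\<Union>?C = ?cl (fib_prod X X') (fib_prod Y Y') (box_graph X X' Y Y' G H)" by blast
  then show ?thesis by (simp add: parr_box_def pmor_def)
qed

section \<open>The near product category of partial morphisms\<close>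

abbreviation P where "P \<equiv> Pfn K"

text \<open>A total morphism is given by a function, and a calculation with total morphisms is a calculation
  with functions.\<close>

definition fgraph where "fgraph X f = (\<lambda>x. (x, f x)) ` fst X"
definition tot where "tot X f Y = pmor X (fgraph X f) Y"

lemma in_fgraph [simp]: "(x, y) \<in> fgraph X f \<longleftrightarrow> x \<in> fst X \<and> y = f x"
  by (auto simp: fgraph_def)

lemma pgraphsD:
  "G \<in> pgraphs X Y \<Longrightarrow> (x, y) \<in> G \<Longrightarrow> x \<in> fst X"
  "G \<in> pgraphs X Y \<Longrightarrow> (x, y) \<in> G \<Longrightarrow> y \<in> fst Y"
  "G \<in> pgraphs X Y \<Longrightarrow> (x, y) \<in> G \<Longrightarrow> colour Y y = colour X x"
  "G \<in> pgraphs X Y \<Longrightarrow> (x, y) \<in> G \<Longrightarrow> (x, y') \<in> G \<Longrightarrow> y' = y"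
  by (auto simp: pgraphs_def single_valued_def)

lemma pgraphsI:
  assumes "\<And>x y. (x, y) \<in> G \<Longrightarrow> x \<in> fst X \<and> y \<in> fst Y \<and> colour Y y = colour X x"
    and "\<And>x y y'. (x, y) \<in> G \<Longrightarrow> (x, y') \<in> G \<Longrightarrow> y = y'"
  shows "G \<in> pgraphs X Y"
  unfolding pgraphs_def single_valued_def using assms by blast

lemma pgraphs_empty [simp]: "{} \<in> pgraphs X Y"
  by (simp add: pgraphs_def)

lemma pgraphs_fgraph: "colour_map X Y f \<Longrightarrow> fgraph X f \<in> pgraphs X Y"
  by (rule pgraphsI) (auto dest: colour_mapD)

lemma pgraphs_comp:
  assumes "G \<in> pgraphs X Y" "H \<in> pgraphs Y Z"
  shows "G O H \<in> pgraphs X Z"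
proof (rule pgraphsI)
  fix x z assume "(x, z) \<in> G O H"
  then obtain y where "(x, y) \<in> G" "(y, z) \<in> H" by blast
  then show "x \<in> fst X \<and> z \<in> fst Z \<and> colour Z z = colour X x"
    using pgraphsD[OF assms(1)] pgraphsD[OF assms(2)] by metis
next
  fix x z z' assume "(x, z) \<in> G O H" "(x, z') \<in> G O H"
  then show "z = z'"
    using pgraphsD(4)[OF assms(1)] pgraphsD(4)[OF assms(2)] by blast
qed

lemma box_graph_in:
  assumes obj: "X \<in> Obj K" "Y \<in> Obj K" "X' \<in> Obj K" "Y' \<in> Obj K"
    and G: "G \<in> pgraphs X Y" and H: "H \<in> pgraphs X' Y'"
  shows "box_graph X X' Y Y' G H \<in> pgraphs (fib_prod X X') (fib_prod Y Y')"
proof (rule pgraphsI)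
  fix z w assume zw: "(z, w) \<in> box_graph X X' Y Y' G H"
  then have "colour (fib_prod Y Y') w = colour (fib_prod X X') z"
    using pgraphsD(3)[OF G, of "prj0 X X' z" "prj0 Y Y' w"] prj_in(3)[OF obj(1,3), of z]
      prj_in(3)[OF obj(2,4), of w]
    by (auto simp: box_graph_def)
  then show "z \<in> fst (fib_prod X X') \<and> w \<in> fst (fib_prod Y Y') \<and>
      colour (fib_prod Y Y') w = colour (fib_prod X X') z"
    using zw by (auto simp: box_graph_def)
next
  fix z w w' assume "(z, w) \<in> box_graph X X' Y Y' G H" "(z, w') \<in> box_graph X X' Y Y' G H"
  then have w: "w \<in> fst (fib_prod Y Y')" "w' \<in> fst (fib_prod Y Y')"
    and G0: "(prj0 X X' z, prj0 Y Y' w') \<in> G" "(prj0 X X' z, prj0 Y Y' w) \<in> G"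
    and H1: "(prj1 X X' z, prj1 Y Y' w') \<in> H" "(prj1 X X' z, prj1 Y Y' w) \<in> H"
    unfolding box_graph_def by blast+
  show "w = w'"
    by (rule times_eqI[OF obj(2,4) w pgraphsD(4)[OF G G0] pgraphsD(4)[OF H H1]])
qed

lemma embed_mor:
  assumes "X \<in> Obj K" "Y \<in> Obj K" "colour_map X Y f"
  shows "embed_arr K (mor X f Y) = tot X f Y"
proof -
  have "(mor X (\<lambda>x. x) X, mor X f Y) \<in> spans K X Y"
    unfolding spans_K[OF assms(1,2)]
    using assms colour_map_id[of X] inj_on_id2[of "fst X"] by blast
  then show ?thesis
    using assms by (simp add: embed_arr_def tot_def pmor_def Idn_K span_class_eq span_graph_mor fgraph_def)
qed

lemma P_simps [simp]:
  "Obj P = Obj K" "Dom P (pmor X G Y) = X" "Cod P (pmor X G Y) = Y"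
  "Dom P (tot X f Y) = X" "Cod P (tot X f Y) = Y"
  "box_obj P X Y = fib_prod X Y"
  by (simp_all add: Pfn_def pmor_def tot_def box_obj_def)

lemma P_Idn [simp]: "X \<in> Obj K \<Longrightarrow> Idn P X = tot X (\<lambda>x. x) X"
  by (simp add: Pfn_def Idn_K embed_mor colour_map_id)

lemma P_Proj [simp]:
  assumes "X \<in> Obj K" "Y \<in> Obj K"
  shows "Proj0 P (X, Y) = tot (fib_prod X Y) (prj0 X Y) X"
    "Proj1 P (X, Y) = tot (fib_prod X Y) (prj1 X Y) Y"
  using assms chosen_cone_mor[OF assms] by (simp_all add: Pfn_def embed_mor)

lemma P_Diag [simp]:
  assumes "X \<in> Obj K"
  shows "Diag P X = tot X (\<lambda>x. pair X X x x) (fib_prod X X)"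
  using assms tuple_mor[OF assms assms assms colour_map_id colour_map_id]
  by (simp add: Pfn_def Idn_K embed_mor)

lemma P_Comp:
  assumes "X \<in> Obj K" "Y \<in> Obj K" "Z \<in> Obj K" "G \<in> pgraphs X Y" "H \<in> pgraphs Y Z"
  shows "pmor Y H Z \<cdot>\<^bsub>P\<^esub> pmor X G Y = pmor X (G O H) Z"
  using parr_comp_pmor[OF assms] by (simp add: Pfn_def)

lemma P_box:
  assumes "X \<in> Obj K" "Y \<in> Obj K" "X' \<in> Obj K" "Y' \<in> Obj K"
    "G \<in> pgraphs X Y" "H \<in> pgraphs X' Y'"
  shows "box_arr P (pmor X G Y) (pmor X' H Y') =
    pmor (fib_prod X X') (box_graph X X' Y Y' G H) (fib_prod Y Y')"
  using parr_box_pmor[OF assms] by (simp add: Pfn_def box_arr_def)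

lemma pmor_hom:
  assumes "X \<in> Obj K" "Y \<in> Obj K"
  shows "f \<in> hom P X Y \<longleftrightarrow> (\<exists>G\<in>pgraphs X Y. f = pmor X G Y)"
  using assms unfolding hom_def mem_Collect_eq Arr_Pfn by (metis P_simps(2,3))

lemma tot_hom:
  assumes "X \<in> Obj K" "Y \<in> Obj K" "colour_map X Y f"
  shows "tot X f Y \<in> hom P X Y"
  unfolding pmor_hom[OF assms(1,2)] tot_def using pgraphs_fgraph[OF assms(3)] by blast

lemma tot_Arr: "X \<in> Obj K \<Longrightarrow> Y \<in> Obj K \<Longrightarrow> colour_map X Y f \<Longrightarrow> tot X f Y \<in> Arr P"
  using tot_hom by (simp add: hom_def)

lemma tot_cong: "(\<And>x. x \<in> fst X \<Longrightarrow> f x = g x) \<Longrightarrow> tot X f Y = tot X g Y"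
  by (auto simp: tot_def fgraph_def cong: image_cong)

lemma tot_Comp:
  assumes "X \<in> Obj K" "Y \<in> Obj K" "Z \<in> Obj K" "colour_map X Y f" "colour_map Y Z g"
  shows "tot Y g Z \<cdot>\<^bsub>P\<^esub> tot X f Y = tot X (\<lambda>x. g (f x)) Z"
proof -
  have "fgraph X f O fgraph Y g = fgraph X (\<lambda>x. g (f x))"
    using colour_mapD[OF assms(4)] by auto
  then show ?thesis
    using assms by (simp add: tot_def P_Comp pgraphs_fgraph)
qed

lemma tot_box:
  assumes obj: "X \<in> Obj K" "Y \<in> Obj K" "X' \<in> Obj K" "Y' \<in> Obj K"
    and f: "colour_map X Y f" and g: "colour_map X' Y' g"
  shows "box_arr P (tot X f Y) (tot X' g Y') =
      tot (fib_prod X X') (\<lambda>z. pair Y Y' (f (prj0 X X' z)) (g (prj1 X X' z))) (fib_prod Y Y')"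
    and "colour_map (fib_prod X X') (fib_prod Y Y')
      (\<lambda>z. pair Y Y' (f (prj0 X X' z)) (g (prj1 X X' z)))"
proof -
  let ?h = "\<lambda>z. pair Y Y' (f (prj0 X X' z)) (g (prj1 X X' z))"
  show h: "colour_map (fib_prod X X') (fib_prod Y Y') ?h"
    using times_mor(2)[OF assms] .
  have "box_graph X X' Y Y' (fgraph X f) (fgraph X' g) = fgraph (fib_prod X X') ?h"
  proof (intro set_eqI)
    fix p :: "'u \<times> 'u"
    obtain z w where p: "p = (z, w)" by (cases p)
    show "p \<in> box_graph X X' Y Y' (fgraph X f) (fgraph X' g) \<longleftrightarrow> p \<in> fgraph (fib_prod X X') ?h"
    proof (cases "z \<in> fst (fib_prod X X')")
      case True
      note z = prj_in[OF obj(1,3) True]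
      note fz = colour_mapD[OF f z(1)] and gz = colour_mapD[OF g z(2)]
      show ?thesis
        using True z fz gz obj by (auto simp: p box_graph_def intro: pair_eqI)
    qed (auto simp: p box_graph_def)
  qed
  then show "box_arr P (tot X f Y) (tot X' g Y') = tot (fib_prod X X') ?h (fib_prod Y Y')"
    using assms by (simp add: tot_def P_box pgraphs_fgraph)
qed

lemma diag_map: "X \<in> Obj K \<Longrightarrow> colour_map X (fib_prod X X) (\<lambda>x. pair X X x x)"
  by (simp add: colour_map_def)

lemma tot_angle:
  assumes obj: "X \<in> Obj K" "Y \<in> Obj K" "W \<in> Obj K"
    and f: "colour_map W X f" and g: "colour_map W Y g"
  shows "angle P (tot W f X) (tot W g Y) = tot W (\<lambda>w. pair X Y (f w) (g w)) (fib_prod X Y)"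
    and "colour_map W (fib_prod X Y) (\<lambda>w. pair X Y (f w) (g w))"
proof -
  show "angle P (tot W f X) (tot W g Y) = tot W (\<lambda>w. pair X Y (f w) (g w)) (fib_prod X Y)"
    using obj tot_box[OF obj(3,1,3,2) f g] diag_map[OF obj(3)]
    by (simp add: angle_def tot_Comp cong: tot_cong)
  show "colour_map W (fib_prod X Y) (\<lambda>w. pair X Y (f w) (g w))"
    using tuple_mor(2)[OF obj f g] .
qed

lemma prj_map:
  assumes "X \<in> Obj K" "Y \<in> Obj K"
  shows "colour_map (fib_prod X Y) X (prj0 X Y)" "colour_map (fib_prod X Y) Y (prj1 X Y)"
  using chosen_cone_mor[OF assms] by auto

definition swap where "swap X Y z = pair Y X (prj1 X Y z) (prj0 X Y z)"

lemma swap_arr_P: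
  assumes "X \<in> Obj K" "Y \<in> Obj K"
  shows "swap_arr P X Y = tot (fib_prod X Y) (swap X Y) (fib_prod Y X)"
    and "colour_map (fib_prod X Y) (fib_prod Y X) (swap X Y)"
  unfolding swap_arr_def swap_def
  using assms tot_angle[OF assms(2,1) times_Obj[OF assms] prj_map(2,1)[OF assms]] by simp_all

definition assoc where
  "assoc X Y Z w = pair X (fib_prod Y Z) (prj0 X Y (prj0 (fib_prod X Y) Z w))
     (pair Y Z (prj1 X Y (prj0 (fib_prod X Y) Z w)) (prj1 (fib_prod X Y) Z w))"

definition coassoc where
  "coassoc X Y Z w = pair (fib_prod X Y) Z (pair X Y (prj0 X (fib_prod Y Z) w)
     (prj0 Y Z (prj1 X (fib_prod Y Z) w))) (prj1 Y Z (prj1 X (fib_prod Y Z) w))"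

lemma assoc_arr_P:
  assumes "X \<in> Obj K" "Y \<in> Obj K" "Z \<in> Obj K"
  shows "assoc_arr P X Y Z = tot (fib_prod (fib_prod X Y) Z) (assoc X Y Z) (fib_prod X (fib_prod Y Z))"
    and "colour_map (fib_prod (fib_prod X Y) Z) (fib_prod X (fib_prod Y Z)) (assoc X Y Z)"
proof -
  let ?W = "fib_prod (fib_prod X Y) Z"
  have T: "?W \<in> Obj K" "fib_prod X Y \<in> Obj K" "fib_prod Y Z \<in> Obj K" using assms by auto
  have p0: "colour_map ?W X (\<lambda>w. prj0 X Y (prj0 (fib_prod X Y) Z w))"
    and p1: "colour_map ?W Y (\<lambda>w. prj1 X Y (prj0 (fib_prod X Y) Z w))"
    and p2: "colour_map ?W Z (prj1 (fib_prod X Y) Z)"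
    using assms by (auto simp: colour_map_def)
  note inner = tot_angle[OF assms(2,3) T(1) p1 p2]
  show "assoc_arr P X Y Z = tot ?W (assoc X Y Z) (fib_prod X (fib_prod Y Z))"
    using assms T p0 p1 p2 inner tot_angle[OF assms(1) T(3,1) p0 inner(2)]
    by (simp add: assoc_arr_def assoc_def[abs_def] tot_Comp prj_map)
  show "colour_map ?W (fib_prod X (fib_prod Y Z)) (assoc X Y Z)"
    unfolding assoc_def[abs_def] using tot_angle(2)[OF assms(1) T(3,1) p0 inner(2)] .
qed

lemma coassoc_map:
  assumes "X \<in> Obj K" "Y \<in> Obj K" "Z \<in> Obj K"
  shows "colour_map (fib_prod X (fib_prod Y Z)) (fib_prod (fib_prod X Y) Z) (coassoc X Y Z)"
  using assms by (simp add: colour_map_def coassoc_def)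

lemma assoc_coassoc:
  assumes "X \<in> Obj K" "Y \<in> Obj K" "Z \<in> Obj K"
  shows "w \<in> fst (fib_prod (fib_prod X Y) Z) \<Longrightarrow> coassoc X Y Z (assoc X Y Z w) = w"
    and "v \<in> fst (fib_prod X (fib_prod Y Z)) \<Longrightarrow> assoc X Y Z (coassoc X Y Z v) = v"
  using assms by (simp_all add: assoc_def coassoc_def)

lemma swap_swap:
  assumes "X \<in> Obj K" "Y \<in> Obj K" "z \<in> fst (fib_prod X Y)"
  shows "swap Y X (swap X Y z) = z"
  using assms by (simp add: swap_def)

lemma Arr_P_dom:
  assumes "f \<in> Arr P" "Dom P f = X"
  shows "X \<in> Obj K \<and> (\<exists>Y\<in>Obj K. \<exists>G\<in>pgraphs X Y. f = pmor X G Y)"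
proof -
  obtain X' Y G where "X' \<in> Obj K" "Y \<in> Obj K" "G \<in> pgraphs X' Y" "f = pmor X' G Y"
    using assms(1) unfolding Arr_Pfn by blast
  then show ?thesis using assms(2) by auto
qed

lemma P_category_axioms: "category P"
proof -
  have unit: "G O fgraph Y (\<lambda>y. y) = G" "fgraph X (\<lambda>y. y) O G = G" if "G \<in> pgraphs X Y" for X Y G
    using pgraphsD(1,2)[OF that] by auto
  show ?thesis
    unfolding category_def
  proof (intro conjI ballI impI)
    fix f assume "f \<in> Arr P"
    then obtain X Y G where f: "X \<in> Obj K" "Y \<in> Obj K" "G \<in> pgraphs X Y" "f = pmor X G Y"
      unfolding Arr_Pfn by blast
    show "Dom P f \<in> Obj P" "Cod P f \<in> Obj P" using f by simp_all
    show "f \<cdot>\<^bsub>P\<^esub> Idn P (Dom P f) = f" "Idn P (Cod P f) \<cdot>\<^bsub>P\<^esub> f = f"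
      using f unit[OF f(3)] by (simp_all add: tot_def P_Comp pgraphs_fgraph colour_map_id)
  next
    fix X assume "X \<in> Obj P"
    then show "Idn P X \<in> hom P X X" by (simp add: tot_hom colour_map_id)
  next
    fix f g assume fg: "f \<in> Arr P" "g \<in> Arr P" "Dom P g = Cod P f"
    obtain X Y G where f: "X \<in> Obj K" "Y \<in> Obj K" "G \<in> pgraphs X Y" "f = pmor X G Y"
      using Arr_P_dom[OF fg(1) refl] by blast
    obtain Z H where g: "Z \<in> Obj K" "H \<in> pgraphs Y Z" "g = pmor Y H Z"
      using Arr_P_dom[OF fg(2,3)] unfolding f(4) P_simps by blast
    show "g \<cdot>\<^bsub>P\<^esub> f \<in> hom P (Dom P f) (Cod P g)"
      using f g pgraphs_comp[OF f(3) g(2)] pmor_hom[OF f(1) g(1)] by (auto simp: P_Comp)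
  next
    fix f g h assume fgh: "f \<in> Arr P" "g \<in> Arr P" "h \<in> Arr P"
      "Dom P g = Cod P f" "Dom P h = Cod P g"
    obtain X Y G where f: "X \<in> Obj K" "Y \<in> Obj K" "G \<in> pgraphs X Y" "f = pmor X G Y"
      using Arr_P_dom[OF fgh(1) refl] by blast
    obtain Z H where g: "Z \<in> Obj K" "H \<in> pgraphs Y Z" "g = pmor Y H Z"
      using Arr_P_dom[OF fgh(2,4)] unfolding f(4) P_simps by blast
    obtain V L where h: "V \<in> Obj K" "L \<in> pgraphs Z V" "h = pmor Z L V"
      using Arr_P_dom[OF fgh(3,5)] unfolding g(3) P_simps by blast
    show "h \<cdot>\<^bsub>P\<^esub> (g \<cdot>\<^bsub>P\<^esub> f) = (h \<cdot>\<^bsub>P\<^esub> g) \<cdot>\<^bsub>P\<^esub> f"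
      using f g h pgraphs_comp[OF f(3) g(2)] pgraphs_comp[OF g(2) h(2)] by (simp add: P_Comp O_assoc)
  qed
qed

text \<open>The witnesses \<open>y\<close> and \<open>y'\<close> in the two coordinates form a pair: both have the colour of the element
  of the product from which they come.\<close>

lemma box_graph_comp:
  assumes obj: "X \<in> Obj K" "Y \<in> Obj K" "Z \<in> Obj K" "X' \<in> Obj K" "Y' \<in> Obj K" "Z' \<in> Obj K"
    and G: "G \<in> pgraphs X Y" "H \<in> pgraphs Y Z" and G': "G' \<in> pgraphs X' Y'" "H' \<in> pgraphs Y' Z'"
  shows "box_graph X X' Z Z' (G O H) (G' O H') =
    box_graph X X' Y Y' G G' O box_graph Y Y' Z Z' H H'"
proof (intro subset_antisym subrelI)
  fix z w assume "(z, w) \<in> box_graph X X' Z Z' (G O H) (G' O H')"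
  then obtain y y' where z: "z \<in> fst (fib_prod X X')" "w \<in> fst (fib_prod Z Z')"
    and y: "(prj0 X X' z, y) \<in> G" "(y, prj0 Z Z' w) \<in> H"
    and y': "(prj1 X X' z, y') \<in> G'" "(y', prj1 Z Z' w) \<in> H'"
    by (auto simp: box_graph_def)
  have "y \<in> fst Y" "y' \<in> fst Y'" "colour Y y = colour Y' y'"
    using pgraphsD(2,3)[OF G(1) y(1)] pgraphsD(2,3)[OF G'(1) y'(1)] prj_in[OF obj(1,4) z(1)]
    by simp_all
  then have "(z, pair Y Y' y y') \<in> box_graph X X' Y Y' G G'"
    "(pair Y Y' y y', w) \<in> box_graph Y Y' Z Z' H H'"
    using z y y' obj by (simp_all add: box_graph_def)
  then show "(z, w) \<in> box_graph X X' Y Y' G G' O box_graph Y Y' Z Z' H H'" by blast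
qed (auto simp: box_graph_def)

lemma box_functor: "is_functor (prod_cat P P) P (Box P)"
  unfolding is_functor_def
proof (intro conjI ballI impI)
  fix X assume "X \<in> Obj (prod_cat P P)"
  then obtain A B where X: "X = (A, B)" "A \<in> Obj K" "B \<in> Obj K" by (auto simp: prod_cat_def)
  show "OMap (Box P) X \<in> Obj P" using times_Obj[OF X(2,3)] by (simp add: X(1) Pfn_def)
  have "AMap (Box P) (Idn (prod_cat P P) X) = box_arr P (Idn P A) (Idn P B)"
    by (simp add: X(1) box_arr_def prod_cat_def)
  also have "\<dots> = tot (fib_prod A B) (\<lambda>x. x) (fib_prod A B)"
    using X by (simp add: tot_box colour_map_id cong: tot_cong)
  also have "\<dots> = Idn P (OMap (Box P) X)"
    using P_Idn[OF times_Obj[OF X(2,3)]] P_simps(6)[of A B] by (simp add: X(1) box_obj_def)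
  finally show "AMap (Box P) (Idn (prod_cat P P) X) = Idn P (OMap (Box P) X)" .
next
  fix f assume "f \<in> Arr (prod_cat P P)"
  then obtain X Y G X' Y' G' where f: "X \<in> Obj K" "Y \<in> Obj K" "X' \<in> Obj K" "Y' \<in> Obj K"
    "G \<in> pgraphs X Y" "G' \<in> pgraphs X' Y'" "f = (pmor X G Y, pmor X' G' Y')"
    by (auto simp: prod_cat_def Arr_Pfn)
  have "box_arr P (pmor X G Y) (pmor X' G' Y') \<in> hom P (fib_prod X X') (fib_prod Y Y')"
    using f box_graph_in[OF f(1-6)] by (auto simp: P_box pmor_hom)
  then show "AMap (Box P) f \<in> hom P (OMap (Box P) (Dom (prod_cat P P) f))
      (OMap (Box P) (Cod (prod_cat P P) f))"
    using P_simps(6)[of X X'] P_simps(6)[of Y Y']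
    by (simp add: f(7) box_arr_def box_obj_def prod_cat_def)
next
  fix f g assume f: "f \<in> Arr (prod_cat P P)" and g: "g \<in> Arr (prod_cat P P)"
    and c: "Dom (prod_cat P P) g = Cod (prod_cat P P) f"
  obtain X Y G X' Y' G' where f: "X \<in> Obj K" "Y \<in> Obj K" "X' \<in> Obj K" "Y' \<in> Obj K"
    "G \<in> pgraphs X Y" "G' \<in> pgraphs X' Y'" "f = (pmor X G Y, pmor X' G' Y')"
    using f by (auto simp: prod_cat_def Arr_Pfn)
  obtain g0 g1 where g01: "g = (g0, g1)" "g0 \<in> Arr P" "g1 \<in> Arr P" "Dom P g0 = Y" "Dom P g1 = Y'"
    using g c by (cases g) (simp add: prod_cat_def f(7))
  obtain Z H Z' H' where g: "Z \<in> Obj K" "Z' \<in> Obj K"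
    "H \<in> pgraphs Y Z" "H' \<in> pgraphs Y' Z'" "g = (pmor Y H Z, pmor Y' H' Z')"
    using Arr_P_dom[OF g01(2,4)] Arr_P_dom[OF g01(3,5)] unfolding g01(1) by blast
  have "box_arr P (pmor Y H Z \<cdot>\<^bsub>P\<^esub> pmor X G Y) (pmor Y' H' Z' \<cdot>\<^bsub>P\<^esub> pmor X' G' Y') =
      box_arr P (pmor Y H Z) (pmor Y' H' Z') \<cdot>\<^bsub>P\<^esub> box_arr P (pmor X G Y) (pmor X' G' Y')"
    using f g box_graph_comp[OF f(1,2) g(1) f(3,4) g(2) f(5) g(3) f(6) g(4)]
      box_graph_in[OF f(1-6)] box_graph_in[OF f(2) g(1) f(4) g(2) g(3,4)]
    by (simp add: P_Comp P_box pgraphs_comp)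
  then show "AMap (Box P) (g \<cdot>\<^bsub>prod_cat P P\<^esub> f) = AMap (Box P) g \<cdot>\<^bsub>P\<^esub> AMap (Box P) f"
    by (simp add: f(7) g(5) box_arr_def prod_cat_def)
qed


text \<open>The common form of the naturality of the symmetry and of the associativity: the square
  commutes if \<open>G\<close> is the preimage of \<open>H\<close> under \<open>a\<close> and \<open>b\<close>. The section \<open>b'\<close> of \<open>b\<close> lifts a value
  of \<open>H\<close> to a value of \<open>G\<close>.\<close>

lemma pmor_square:
  assumes obj: "X \<in> Obj K" "Y \<in> Obj K" "X' \<in> Obj K" "Y' \<in> Obj K"
    and G: "G \<in> pgraphs X Y" "H \<in> pgraphs X' Y'"
    and a: "colour_map X X' a" and b: "colour_map Y Y' b" and b': "colour_map Y' Y b'"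
    and surj: "\<And>y. y \<in> fst Y' \<Longrightarrow> b (b' y) = y"
    and eq: "\<And>x y. x \<in> fst X \<Longrightarrow> y \<in> fst Y \<Longrightarrow> (x, y) \<in> G \<longleftrightarrow> (a x, b y) \<in> H"
  shows "tot Y b Y' \<cdot>\<^bsub>P\<^esub> pmor X G Y = pmor X' H Y' \<cdot>\<^bsub>P\<^esub> tot X a X'"
proof -
  have "G O fgraph Y b = fgraph X a O H"
  proof (intro subset_antisym subrelI)
    fix x v assume "(x, v) \<in> G O fgraph Y b"
    then obtain y where y: "(x, y) \<in> G" "y \<in> fst Y" "v = b y" by auto
    have x: "x \<in> fst X" using pgraphsD(1)[OF G(1) y(1)] .
    then have "(a x, v) \<in> H" using eq[OF x y(2)] y(1,3) by simp
    then show "(x, v) \<in> fgraph X a O H" using x by auto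
  next
    fix x v assume "(x, v) \<in> fgraph X a O H"
    then have xv: "x \<in> fst X" "(a x, v) \<in> H" by auto
    then have v: "v \<in> fst Y'" using pgraphsD(2)[OF G(2)] by blast
    then have "(x, b' v) \<in> G" "b' v \<in> fst Y" "v = b (b' v)"
      using xv eq[OF xv(1), of "b' v"] surj colour_mapD[OF b'] by auto
    then show "(x, v) \<in> G O fgraph Y b" by auto
  qed
  then show ?thesis
    using assms by (simp add: tot_def P_Comp pgraphs_fgraph)
qed

lemma tot_iso:
  assumes "X \<in> Obj K" "Y \<in> Obj K" "colour_map X Y f" "colour_map Y X g"
    and "\<And>x. x \<in> fst X \<Longrightarrow> g (f x) = x" "\<And>y. y \<in> fst Y \<Longrightarrow> f (g y) = y"
  shows "iso_arr P (tot X f Y)"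
  unfolding iso_arr_def
  using assms by (auto intro!: tot_Arr bexI[of _ "tot Y g X"] tot_hom simp: tot_Comp cong: tot_cong)

text \<open>The diagonal is natural for partial morphisms because \<open>G\<close> is single-valued: if both coordinates of
  \<open>v\<close> are values of \<open>G\<close> at the same \<open>x\<close>, they are equal.\<close>

lemma diag_natural:
  "natural P P \<lparr>OMap = id, AMap = id\<rparr>
     \<lparr>OMap = \<lambda>X. box_obj P X X, AMap = \<lambda>f. box_arr P f f\<rparr> (Diag P)"
  unfolding natural_def infranatural_def natural_on_def
proof (intro conjI ballI)
  fix X assume "X \<in> Obj P"
  then show "Diag P X \<in> hom P (OMap \<lparr>OMap = id, AMap = id\<rparr> X)
      (OMap \<lparr>OMap = \<lambda>X. box_obj P X X, AMap = \<lambda>f. box_arr P f f\<rparr> X)"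
    by (simp add: tot_hom diag_map)
next
  fix f assume "f \<in> Arr P"
  then obtain X Y G where f: "X \<in> Obj K" "Y \<in> Obj K" "G \<in> pgraphs X Y" "f = pmor X G Y"
    unfolding Arr_Pfn by blast
  have "G O fgraph Y (\<lambda>y. pair Y Y y y) = fgraph X (\<lambda>x. pair X X x x) O box_graph X X Y Y G G"
  proof (intro subset_antisym subrelI)
    fix x v assume "(x, v) \<in> G O fgraph Y (\<lambda>y. pair Y Y y y)"
    then obtain y where y: "(x, y) \<in> G" "v = pair Y Y y y" by auto
    have "x \<in> fst X" "y \<in> fst Y" using pgraphsD(1,2)[OF f(3) y(1)] .
    then show "(x, v) \<in> fgraph X (\<lambda>x. pair X X x x) O box_graph X X Y Y G G"
      using y f by (intro relcompI[of _ "pair X X x x"]) (simp_all add: box_graph_def)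
  next
    fix x v assume "(x, v) \<in> fgraph X (\<lambda>x. pair X X x x) O box_graph X X Y Y G G"
    then have x: "x \<in> fst X" and v: "v \<in> fst (fib_prod Y Y)" "(x, prj0 Y Y v) \<in> G" "(x, prj1 Y Y v) \<in> G"
      using f by (auto simp: box_graph_def)
    have "pair Y Y (prj0 Y Y v) (prj0 Y Y v) = v"
      using pair_prj[OF f(2,2) v(1)] pgraphsD(4)[OF f(3) v(2,3)] by simp
    then show "(x, v) \<in> G O fgraph Y (\<lambda>y. pair Y Y y y)"
      using v(2) pgraphsD(2)[OF f(3) v(2)] by auto
  qed
  then show "Diag P (Cod P f) \<cdot>\<^bsub>P\<^esub> AMap \<lparr>OMap = id, AMap = id\<rparr> f =
      AMap \<lparr>OMap = \<lambda>X. box_obj P X X, AMap = \<lambda>f. box_arr P f f\<rparr> f \<cdot>\<^bsub>P\<^esub> Diag P (Dom P f)"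
    using f by (simp add: diag_map tot_def P_Comp P_box box_graph_in pgraphs_fgraph)
qed

lemma swap_natural_iso:
  "natural_iso (prod_cat P P) P (Box P)
     \<lparr>OMap = \<lambda>(X, Y). box_obj P Y X, AMap = \<lambda>(f, g). box_arr P g f\<rparr>
     (\<lambda>(X, Y). swap_arr P X Y)"
proof -
  have Box: "OMap (Box P) (X, Y) = fib_prod X Y" "AMap (Box P) (f, g) = box_arr P f g" for X Y f g
    using P_simps(6)[of X Y] by (simp_all add: box_arr_def box_obj_def)
  have hom: "swap_arr P X Y \<in> hom P (fib_prod X Y) (fib_prod Y X)" "iso_arr P (swap_arr P X Y)"
    if "X \<in> Obj K" "Y \<in> Obj K" for X Y
    using that swap_arr_P[OF that] swap_arr_P[OF that(2,1)] swap_swap[OF that] swap_swap[OF that(2,1)]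
    by (auto intro!: tot_hom tot_iso)
  have nat: "swap_arr P Y Y' \<cdot>\<^bsub>P\<^esub> box_arr P (pmor X G Y) (pmor X' G' Y') =
      box_arr P (pmor X' G' Y') (pmor X G Y) \<cdot>\<^bsub>P\<^esub> swap_arr P X X'"
    if obj: "X \<in> Obj K" "Y \<in> Obj K" "X' \<in> Obj K" "Y' \<in> Obj K"
      and G: "G \<in> pgraphs X Y" "G' \<in> pgraphs X' Y'" for X Y X' Y' G G'
    unfolding P_box[OF obj G] P_box[OF obj(3,4,1,2) G(2,1)]
      swap_arr_P(1)[OF obj(2,4)] swap_arr_P(1)[OF obj(1,3)]
  proof (rule pmor_square)
    show "box_graph X X' Y Y' G G' \<in> pgraphs (fib_prod X X') (fib_prod Y Y')"
      "box_graph X' X Y' Y G' G \<in> pgraphs (fib_prod X' X) (fib_prod Y' Y)"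
      using box_graph_in[OF obj G] box_graph_in[OF obj(3,4,1,2) G(2,1)] by auto
    show "colour_map (fib_prod Y' Y) (fib_prod Y Y') (swap Y' Y)"
      using swap_arr_P(2)[OF obj(4,2)] .
    fix z w assume "z \<in> fst (fib_prod X X')" "w \<in> fst (fib_prod Y Y')"
    then show "(z, w) \<in> box_graph X X' Y Y' G G' \<longleftrightarrow>
        (swap X X' z, swap Y Y' w) \<in> box_graph X' X Y' Y G' G"
      using obj by (auto simp: box_graph_def swap_def)
  qed (use obj swap_arr_P(2) swap_swap in auto)
  show ?thesis
    unfolding natural_iso_def natural_def infranatural_def natural_on_def
  proof (intro conjI ballI)
    fix XY assume "XY \<in> Obj (prod_cat P P)"
    then obtain X Y where XY: "XY = (X, Y)" "X \<in> Obj K" "Y \<in> Obj K" by (auto simp: prod_cat_def)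
    show "(case XY of (X, Y) \<Rightarrow> swap_arr P X Y) \<in> hom P (OMap (Box P) XY)
        (OMap \<lparr>OMap = \<lambda>(X, Y). box_obj P Y X, AMap = \<lambda>(f, g). box_arr P g f\<rparr> XY)"
      using hom[OF XY(2,3)] by (simp add: XY(1) Box)
    show "iso_arr P (case XY of (X, Y) \<Rightarrow> swap_arr P X Y)"
      using hom[OF XY(2,3)] by (simp add: XY(1))
  next
    fix f assume "f \<in> Arr (prod_cat P P)"
    then obtain X Y G X' Y' G' where f: "X \<in> Obj K" "Y \<in> Obj K" "X' \<in> Obj K" "Y' \<in> Obj K"
      "G \<in> pgraphs X Y" "G' \<in> pgraphs X' Y'" "f = (pmor X G Y, pmor X' G' Y')"
      by (auto simp: prod_cat_def Arr_Pfn)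
    show "(case Cod (prod_cat P P) f of (X, Y) \<Rightarrow> swap_arr P X Y) \<cdot>\<^bsub>P\<^esub> AMap (Box P) f =
        AMap \<lparr>OMap = \<lambda>(X, Y). box_obj P Y X, AMap = \<lambda>(f, g). box_arr P g f\<rparr> f \<cdot>\<^bsub>P\<^esub>
          (case Dom (prod_cat P P) f of (X, Y) \<Rightarrow> swap_arr P X Y)"
      using nat[OF f(1-6)] by (simp add: f(7) Box prod_cat_def)
  qed
qed

lemma assoc_natural_iso:
  "natural_iso (prod_cat (prod_cat P P) P) P
     \<lparr>OMap = \<lambda>((X, Y), Z). box_obj P (box_obj P X Y) Z,
      AMap = \<lambda>((f, g), h). box_arr P (box_arr P f g) h\<rparr>
     \<lparr>OMap = \<lambda>((X, Y), Z). box_obj P X (box_obj P Y Z),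
      AMap = \<lambda>((f, g), h). box_arr P f (box_arr P g h)\<rparr>
     (\<lambda>((X, Y), Z). assoc_arr P X Y Z)"
proof -
  have hom: "assoc_arr P X Y Z \<in> hom P (fib_prod (fib_prod X Y) Z) (fib_prod X (fib_prod Y Z))"
    "iso_arr P (assoc_arr P X Y Z)"
    if "X \<in> Obj K" "Y \<in> Obj K" "Z \<in> Obj K" for X Y Z
    using that assoc_arr_P[OF that] assoc_coassoc[OF that] coassoc_map[OF that]
    by (auto intro!: tot_hom tot_iso[where g = "coassoc X Y Z"])
  have nat: "assoc_arr P X' Y' Z' \<cdot>\<^bsub>P\<^esub> box_arr P (box_arr P (pmor X F X') (pmor Y G Y')) (pmor Z H Z') =
      box_arr P (pmor X F X') (box_arr P (pmor Y G Y') (pmor Z H Z')) \<cdot>\<^bsub>P\<^esub> assoc_arr P X Y Z"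
    if obj: "X \<in> Obj K" "Y \<in> Obj K" "Z \<in> Obj K" and obj': "X' \<in> Obj K" "Y' \<in> Obj K" "Z' \<in> Obj K"
      and G: "F \<in> pgraphs X X'" "G \<in> pgraphs Y Y'" "H \<in> pgraphs Z Z'" for X Y Z X' Y' Z' F G H
  proof -
    note FG = box_graph_in[OF obj(1) obj'(1) obj(2) obj'(2) G(1,2)]
    note GH = box_graph_in[OF obj(2) obj'(2) obj(3) obj'(3) G(2,3)]
    note T = times_Obj[OF obj(1,2)] times_Obj[OF obj(2,3)]
    note T' = times_Obj[OF obj'(1,2)] times_Obj[OF obj'(2,3)]
    note FGH = box_graph_in[OF T(1) T'(1) obj(3) obj'(3) FG G(3)]
      box_graph_in[OF obj(1) obj'(1) T(2) T'(2) G(1) GH]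
    show ?thesis
      unfolding assoc_arr_P(1)[OF obj] assoc_arr_P(1)[OF obj']
        P_box[OF obj(1) obj'(1) obj(2) obj'(2) G(1,2)] P_box[OF obj(2) obj'(2) obj(3) obj'(3) G(2,3)]
        P_box[OF T(1) T'(1) obj(3) obj'(3) FG G(3)] P_box[OF obj(1) obj'(1) T(2) T'(2) G(1) GH]
    proof (rule pmor_square[OF _ _ _ _ FGH assoc_arr_P(2)[OF obj] assoc_arr_P(2)[OF obj']
          coassoc_map[OF obj']])
      fix z w assume z: "z \<in> fst (fib_prod (fib_prod X Y) Z)" and w: "w \<in> fst (fib_prod (fib_prod X' Y') Z')"
      show "(z, w) \<in> box_graph (fib_prod X Y) Z (fib_prod X' Y') Z' (box_graph X Y X' Y' F G) H \<longleftrightarrow>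
        (assoc X Y Z z, assoc X' Y' Z' w) \<in>
          box_graph X (fib_prod Y Z) X' (fib_prod Y' Z') F (box_graph Y Z Y' Z' G H)"
        using z w obj obj' by (auto simp: box_graph_def assoc_def)
    qed (use obj obj' T T' assoc_coassoc(2)[OF obj'] in auto)
  qed
  show ?thesis
    unfolding natural_iso_def natural_def infranatural_def natural_on_def
  proof (intro conjI ballI)
    fix V assume "V \<in> Obj (prod_cat (prod_cat P P) P)"
    then obtain X Y Z where V: "V = ((X, Y), Z)" "X \<in> Obj K" "Y \<in> Obj K" "Z \<in> Obj K"
      by (auto simp: prod_cat_def)
    show "(case V of (XY, Z) \<Rightarrow> (case XY of (X, Y) \<Rightarrow> assoc_arr P X Y) Z) \<in> hom P
       (OMap \<lparr>OMap = \<lambda>((X, Y), Z). box_obj P (box_obj P X Y) Z,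
          AMap = \<lambda>((f, g), h). box_arr P (box_arr P f g) h\<rparr> V)
       (OMap \<lparr>OMap = \<lambda>((X, Y), Z). box_obj P X (box_obj P Y Z),
          AMap = \<lambda>((f, g), h). box_arr P f (box_arr P g h)\<rparr> V)"
      using hom[OF V(2-4)] by (simp add: V(1))
    show "iso_arr P (case V of (XY, Z) \<Rightarrow> (case XY of (X, Y) \<Rightarrow> assoc_arr P X Y) Z)"
      using hom[OF V(2-4)] by (simp add: V(1))
  next
    fix f assume "f \<in> Arr (prod_cat (prod_cat P P) P)"
    then obtain X Y Z X' Y' Z' F G H where f: "X \<in> Obj K" "Y \<in> Obj K" "Z \<in> Obj K" "X' \<in> Obj K"
      "Y' \<in> Obj K" "Z' \<in> Obj K" "F \<in> pgraphs X X'" "G \<in> pgraphs Y Y'" "H \<in> pgraphs Z Z'"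
      "f = ((pmor X F X', pmor Y G Y'), pmor Z H Z')"
      by (auto simp: prod_cat_def Arr_Pfn)
    show "(case Cod (prod_cat (prod_cat P P) P) f of
            (XY, Z) \<Rightarrow> (case XY of (X, Y) \<Rightarrow> assoc_arr P X Y) Z) \<cdot>\<^bsub>P\<^esub>
         AMap \<lparr>OMap = \<lambda>((X, Y), Z). box_obj P (box_obj P X Y) Z,
          AMap = \<lambda>((f, g), h). box_arr P (box_arr P f g) h\<rparr> f =
         AMap \<lparr>OMap = \<lambda>((X, Y), Z). box_obj P X (box_obj P Y Z),
          AMap = \<lambda>((f, g), h). box_arr P f (box_arr P g h)\<rparr> f \<cdot>\<^bsub>P\<^esub>
         (case Dom (prod_cat (prod_cat P P) P) f of
            (XY, Z) \<Rightarrow> (case XY of (X, Y) \<Rightarrow> assoc_arr P X Y) Z)"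
      using nat[OF f(1-9)] by (simp add: f(10) prod_cat_def)
  qed
qed

text \<open>The total morphisms form a wide subcategory on which the projections are natural in the factor
  that is discarded. It contains the projections and is closed under the near product, so it
  contains the whole subcategory that the projections generate.\<close>

definition totals where
  "totals = {tot X f Y | X f Y. X \<in> Obj K \<and> Y \<in> Obj K \<and> colour_map X Y f}"

lemma totalsI: "X \<in> Obj K \<Longrightarrow> Y \<in> Obj K \<Longrightarrow> colour_map X Y f \<Longrightarrow> tot X f Y \<in> totals"
  unfolding totals_def by blast

lemma totalsE:
  assumes "f \<in> totals"
  obtains X h Y where "X \<in> Obj K" "Y \<in> Obj K" "colour_map X Y h" "f = tot X h Y"
  using assms unfolding totals_def by blast

lemma totals_subcategory: "wide_subcategory P totals"
  unfolding wide_subcategory_def subcategory_def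
proof (intro conjI ballI impI)
  show "totals \<subseteq> Arr P" by (intro subsetI) (erule totalsE, simp add: tot_Arr)
  show "Idn P ` Obj P \<subseteq> totals"
    by (auto intro!: totalsI colour_map_id)
next
  fix f assume "f \<in> totals"
  then show "Idn P (Dom P f) \<in> totals" "Idn P (Cod P f) \<in> totals"
    by (auto elim!: totalsE[of f] intro!: totalsI colour_map_id)
next
  fix f g assume fg: "f \<in> totals" "g \<in> totals" "Dom P g = Cod P f"
  obtain X h Y where f: "X \<in> Obj K" "Y \<in> Obj K" "colour_map X Y h" "f = tot X h Y"
    using fg(1) by (rule totalsE)
  obtain Y' k Z where g: "Y' \<in> Obj K" "Z \<in> Obj K" "colour_map Y' Z k" "g = tot Y' k Z"
    using fg(2) by (rule totalsE)
  have "Y' = Y" using fg(3) f(4) g(4) by simp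
  then show "g \<cdot>\<^bsub>P\<^esub> f \<in> totals"
    using f g by (simp add: tot_Comp totalsI colour_map_comp)
qed

lemma totals_box:
  assumes "f \<in> totals" "g \<in> totals"
  shows "box_arr P f g \<in> totals"
proof -
  obtain X h Y where f: "X \<in> Obj K" "Y \<in> Obj K" "colour_map X Y h" "f = tot X h Y"
    using assms(1) by (rule totalsE)
  obtain X' k Y' where g: "X' \<in> Obj K" "Y' \<in> Obj K" "colour_map X' Y' k" "g = tot X' k Y'"
    using assms(2) by (rule totalsE)
  show ?thesis
    using f g tot_box[OF f(1,2) g(1,2) f(3) g(3)] by (simp add: totalsI)
qed

lemma proj_subcategory_totals: "proj_subcategory P \<subseteq> totals"
proof -
  have "\<forall>X\<in>Obj P. \<forall>Y\<in>Obj P. Proj0 P (X, Y) \<in> totals \<and> Proj1 P (X, Y) \<in> totals"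
    using prj_map by (simp add: totalsI)
  then show ?thesis
    using totals_subcategory totals_box unfolding proj_subcategory_def wide_subcategory_def by blast
qed

text \<open>The two sides of the square for \<open>p\<^sub>0\<close> can differ only in their domains of definition: the left side
  also needs the discarded factor to be defined, which is automatic when that factor is total.\<close>

lemma proj_natural:
  assumes obj: "X \<in> Obj K" "Y \<in> Obj K" "X' \<in> Obj K" "Y' \<in> Obj K"
    and G: "G \<in> pgraphs X Y" and t: "colour_map X' Y' t"
  shows "Proj0 P (Y, Y') \<cdot>\<^bsub>P\<^esub> box_arr P (pmor X G Y) (tot X' t Y') = pmor X G Y \<cdot>\<^bsub>P\<^esub> Proj0 P (X, X')"
    and "Proj1 P (Y', Y) \<cdot>\<^bsub>P\<^esub> box_arr P (tot X' t Y') (pmor X G Y) = pmor X G Y \<cdot>\<^bsub>P\<^esub> Proj1 P (X', X)"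
proof -
  note T = pgraphs_fgraph[OF t]
  note B0 = box_graph_in[OF obj G T] and B1 = box_graph_in[OF obj(3,4,1,2) T G]
  have "box_graph X X' Y Y' G (fgraph X' t) O fgraph (fib_prod Y Y') (prj0 Y Y') =
      fgraph (fib_prod X X') (prj0 X X') O G"
  proof (intro subset_antisym subrelI)
    fix z y assume "(z, y) \<in> box_graph X X' Y Y' G (fgraph X' t) O fgraph (fib_prod Y Y') (prj0 Y Y')"
    then show "(z, y) \<in> fgraph (fib_prod X X') (prj0 X X') O G"
      by (auto simp: box_graph_def)
  next
    fix z y assume "(z, y) \<in> fgraph (fib_prod X X') (prj0 X X') O G"
    then have z: "z \<in> fst (fib_prod X X')" and y: "(prj0 X X' z, y) \<in> G" by auto
    have ty: "t (prj1 X X' z) \<in> fst Y'" "colour Y' (t (prj1 X X' z)) = colour Y y" "y \<in> fst Y"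
      using colour_mapD[OF t, of "prj1 X X' z"] prj_in[OF obj(1,3) z] pgraphsD(2,3)[OF G y] by simp_all
    then show "(z, y) \<in> box_graph X X' Y Y' G (fgraph X' t) O fgraph (fib_prod Y Y') (prj0 Y Y')"
      using obj z y by (intro relcompI[of _ "pair Y Y' y (t (prj1 X X' z))"]) (simp_all add: box_graph_def)
  qed
  then show "Proj0 P (Y, Y') \<cdot>\<^bsub>P\<^esub> box_arr P (pmor X G Y) (tot X' t Y') = pmor X G Y \<cdot>\<^bsub>P\<^esub> Proj0 P (X, X')"
    using obj G T B0 prj_map by (simp add: tot_def P_Comp P_box pgraphs_fgraph)
  have "box_graph X' X Y' Y (fgraph X' t) G O fgraph (fib_prod Y' Y) (prj1 Y' Y) =
      fgraph (fib_prod X' X) (prj1 X' X) O G"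
  proof (intro subset_antisym subrelI)
    fix z y assume "(z, y) \<in> box_graph X' X Y' Y (fgraph X' t) G O fgraph (fib_prod Y' Y) (prj1 Y' Y)"
    then show "(z, y) \<in> fgraph (fib_prod X' X) (prj1 X' X) O G"
      by (auto simp: box_graph_def)
  next
    fix z y assume "(z, y) \<in> fgraph (fib_prod X' X) (prj1 X' X) O G"
    then have z: "z \<in> fst (fib_prod X' X)" and y: "(prj1 X' X z, y) \<in> G" by auto
    have ty: "t (prj0 X' X z) \<in> fst Y'" "colour Y' (t (prj0 X' X z)) = colour Y y" "y \<in> fst Y"
      using colour_mapD[OF t, of "prj0 X' X z"] prj_in[OF obj(3,1) z] pgraphsD(2,3)[OF G y] by simp_all
    then show "(z, y) \<in> box_graph X' X Y' Y (fgraph X' t) G O fgraph (fib_prod Y' Y) (prj1 Y' Y)"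
      using obj z y by (intro relcompI[of _ "pair Y' Y (t (prj0 X' X z)) y"]) (simp_all add: box_graph_def)
  qed
  then show "Proj1 P (Y', Y) \<cdot>\<^bsub>P\<^esub> box_arr P (tot X' t Y') (pmor X G Y) = pmor X G Y \<cdot>\<^bsub>P\<^esub> Proj1 P (X', X)"
    using obj G T B1 prj_map by (simp add: tot_def P_Comp P_box pgraphs_fgraph)
qed

lemma wide_prod:
  assumes "wide_subcategory P S" "wide_subcategory P T"
  shows "wide_subcategory (prod_cat P P) (S \<times> T)"
  using assms unfolding wide_subcategory_def subcategory_def prod_cat_def by auto

lemma wide_Arr: "wide_subcategory P (Arr P)"
  using P_category_axioms unfolding wide_subcategory_def subcategory_def category_def hom_def
  by auto

text \<open>The pairs of an arbitrary morphism, for the factor that is kept, and a total morphism, for the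
  factor that is discarded, form a wide subcategory on which the projection is natural; hence they
  lie in the largest one.\<close>

lemma nat_part_proj:
  "Arr P \<times> proj_subcategory P \<subseteq>
     nat_part (prod_cat P P) P (Box P) \<lparr>OMap = fst, AMap = fst\<rparr> (Proj0 P)"
  "proj_subcategory P \<times> Arr P \<subseteq>
     nat_part (prod_cat P P) P (Box P) \<lparr>OMap = snd, AMap = snd\<rparr> (Proj1 P)"
proof -
  have Box: "AMap (Box P) (f, g) = box_arr P f g" for f g by (simp add: box_arr_def)
  have "natural_on (prod_cat P P) P (Box P) \<lparr>OMap = fst, AMap = fst\<rparr> (Proj0 P) (Arr P \<times> totals)"
    unfolding natural_on_def
  proof (intro ballI)
    fix f assume "f \<in> Arr P \<times> totals"
    then obtain g t where f: "f = (g, t)" "g \<in> Arr P" "t \<in> totals" by blast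
    obtain X Y G where g: "X \<in> Obj K" "Y \<in> Obj K" "G \<in> pgraphs X Y" "g = pmor X G Y"
      using f(2) unfolding Arr_Pfn by blast
    obtain X' h Y' where t: "X' \<in> Obj K" "Y' \<in> Obj K" "colour_map X' Y' h" "t = tot X' h Y'"
      using f(3) by (rule totalsE)
    show "Proj0 P (Cod (prod_cat P P) f) \<cdot>\<^bsub>P\<^esub> AMap (Box P) f =
        AMap \<lparr>OMap = fst, AMap = fst\<rparr> f \<cdot>\<^bsub>P\<^esub> Proj0 P (Dom (prod_cat P P) f)"
      using proj_natural(1)[OF g(1,2) t(1,2) g(3) t(3)]
      by (simp add: f(1) g(4) t(4) Box prod_cat_def del: P_Proj)
  qed
  then have "Arr P \<times> totals \<subseteq>
     nat_part (prod_cat P P) P (Box P) \<lparr>OMap = fst, AMap = fst\<rparr> (Proj0 P)"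
    unfolding nat_part_def using wide_prod[OF wide_Arr totals_subcategory] by blast
  then show "Arr P \<times> proj_subcategory P \<subseteq>
     nat_part (prod_cat P P) P (Box P) \<lparr>OMap = fst, AMap = fst\<rparr> (Proj0 P)"
    using proj_subcategory_totals by blast
  have "natural_on (prod_cat P P) P (Box P) \<lparr>OMap = snd, AMap = snd\<rparr> (Proj1 P) (totals \<times> Arr P)"
    unfolding natural_on_def
  proof (intro ballI)
    fix f assume "f \<in> totals \<times> Arr P"
    then obtain g t where f: "f = (t, g)" "g \<in> Arr P" "t \<in> totals" by blast
    obtain X Y G where g: "X \<in> Obj K" "Y \<in> Obj K" "G \<in> pgraphs X Y" "g = pmor X G Y"
      using f(2) unfolding Arr_Pfn by blast
    obtain X' h Y' where t: "X' \<in> Obj K" "Y' \<in> Obj K" "colour_map X' Y' h" "t = tot X' h Y'"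
      using f(3) by (rule totalsE)
    show "Proj1 P (Cod (prod_cat P P) f) \<cdot>\<^bsub>P\<^esub> AMap (Box P) f =
        AMap \<lparr>OMap = snd, AMap = snd\<rparr> f \<cdot>\<^bsub>P\<^esub> Proj1 P (Dom (prod_cat P P) f)"
      using proj_natural(2)[OF g(1,2) t(1,2) g(3) t(3)]
      by (simp add: f(1) g(4) t(4) Box prod_cat_def del: P_Proj)
  qed
  then have "totals \<times> Arr P \<subseteq>
     nat_part (prod_cat P P) P (Box P) \<lparr>OMap = snd, AMap = snd\<rparr> (Proj1 P)"
    unfolding nat_part_def using wide_prod[OF totals_subcategory wide_Arr] by blast
  then show "proj_subcategory P \<times> Arr P \<subseteq>
     nat_part (prod_cat P P) P (Box P) \<lparr>OMap = snd, AMap = snd\<rparr> (Proj1 P)"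
    using proj_subcategory_totals by blast
qed

lemma proj_infranatural:
  "infranatural (prod_cat P P) P (Box P) \<lparr>OMap = fst, AMap = fst\<rparr> (Proj0 P)"
  "infranatural (prod_cat P P) P (Box P) \<lparr>OMap = snd, AMap = snd\<rparr> (Proj1 P)"
proof -
  have Box: "OMap (Box P) (X, Y) = fib_prod X Y" for X Y
    using P_simps(6)[of X Y] by (simp add: box_obj_def)
  show "infranatural (prod_cat P P) P (Box P) \<lparr>OMap = fst, AMap = fst\<rparr> (Proj0 P)"
    "infranatural (prod_cat P P) P (Box P) \<lparr>OMap = snd, AMap = snd\<rparr> (Proj1 P)"
    unfolding infranatural_def
    by (auto simp: prod_cat_def Box prj_map intro!: tot_hom simp del: prod.collapse)
qed

lemma diag_proj:
  assumes X: "X \<in> Obj K"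
  shows "Proj0 P (X, X) \<cdot>\<^bsub>P\<^esub> Diag P X = Idn P X"
    and "Proj1 P (X, X) \<cdot>\<^bsub>P\<^esub> Diag P X = Idn P X"
    and "box_arr P (Proj0 P (X, X)) (Proj1 P (X, X)) \<cdot>\<^bsub>P\<^esub> Diag P (fib_prod X X) = Idn P (fib_prod X X)"
proof -
  show "Proj0 P (X, X) \<cdot>\<^bsub>P\<^esub> Diag P X = Idn P X" "Proj1 P (X, X) \<cdot>\<^bsub>P\<^esub> Diag P X = Idn P X"
    using X diag_map[OF X] prj_map[OF X X] by (simp_all add: tot_Comp cong: tot_cong)
  have T: "fib_prod X X \<in> Obj K" using X by simp
  show "box_arr P (Proj0 P (X, X)) (Proj1 P (X, X)) \<cdot>\<^bsub>P\<^esub> Diag P (fib_prod X X) = Idn P (fib_prod X X)"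
    using X T diag_map[OF T] tot_box[OF T X T X prj_map[OF X X]]
    by (simp add: tot_Comp cong: tot_cong)
qed

lemma pentagon:
  assumes obj: "W \<in> Obj K" "X \<in> Obj K" "Y \<in> Obj K" "Z \<in> Obj K"
  shows "assoc_arr P W X (fib_prod Y Z) \<cdot>\<^bsub>P\<^esub> assoc_arr P (fib_prod W X) Y Z =
         box_arr P (Idn P W) (assoc_arr P X Y Z) \<cdot>\<^bsub>P\<^esub>
           (assoc_arr P W (fib_prod X Y) Z \<cdot>\<^bsub>P\<^esub> box_arr P (assoc_arr P W X Y) (Idn P Z))"
proof -
  note T = times_Obj[OF obj(1,2)] times_Obj[OF obj(2,3)] times_Obj[OF obj(3,4)]
  note a1 = assoc_arr_P[OF obj(1,2) T(3)] and a2 = assoc_arr_P[OF T(1) obj(3,4)]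
    and a3 = assoc_arr_P[OF obj(2-4)] and a4 = assoc_arr_P[OF obj(1) T(2) obj(4)]
    and a5 = assoc_arr_P[OF obj(1-3)]
  note b3 = tot_box[OF obj(1,1) _ _ colour_map_id a3(2)]
    and b5 = tot_box[OF _ _ obj(4,4) a5(2) colour_map_id]
  show ?thesis
    unfolding a1 a2 a3 a4 a5 P_Idn[OF obj(1)] P_Idn[OF obj(4)]
    using obj T a1(2) a2(2) a4(2) b3 b5
    by (simp add: tot_Comp colour_map_comp[OF b5(2) a4(2)]) (intro tot_cong; simp add: assoc_def)
qed

lemma hexagon:
  assumes obj: "X \<in> Obj K" "Y \<in> Obj K" "Z \<in> Obj K"
  shows "assoc_arr P Y Z X \<cdot>\<^bsub>P\<^esub> (swap_arr P X (fib_prod Y Z) \<cdot>\<^bsub>P\<^esub> assoc_arr P X Y Z) =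
         box_arr P (Idn P Y) (swap_arr P X Z) \<cdot>\<^bsub>P\<^esub>
           (assoc_arr P Y X Z \<cdot>\<^bsub>P\<^esub> box_arr P (swap_arr P X Y) (Idn P Z))"
proof -
  note T = times_Obj[OF obj(2,3)] times_Obj[OF obj(1,2)] times_Obj[OF obj(2,1)]
    times_Obj[OF obj(1,3)] times_Obj[OF obj(3,1)]
  note a1 = assoc_arr_P[OF obj(2,3,1)] and a2 = assoc_arr_P[OF obj(1-3)]
    and a3 = assoc_arr_P[OF obj(2,1,3)]
    and s1 = swap_arr_P[OF obj(1) T(1)] and s2 = swap_arr_P[OF obj(1,3)] and s3 = swap_arr_P[OF obj(1,2)]
  note b2 = tot_box[OF obj(2,2) T(4,5) colour_map_id s2(2)]
    and b3 = tot_box[OF T(2,3) obj(3,3) s3(2) colour_map_id]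
  show ?thesis
    unfolding a1 a2 a3 s1 s2 s3 P_Idn[OF obj(2)] P_Idn[OF obj(3)] b2(1) b3(1)
    using obj T a1(2) a2(2) a3(2) s1(2) b2(2) b3(2)
    by (simp add: tot_Comp colour_map_comp[OF a2(2) s1(2)] colour_map_comp[OF b3(2) a3(2)])
      (intro tot_cong; simp add: assoc_def swap_def)
qed

lemma symmetry:
  assumes "X \<in> Obj K" "Y \<in> Obj K"
  shows "swap_arr P Y X \<cdot>\<^bsub>P\<^esub> swap_arr P X Y = Idn P (fib_prod X Y)"
  using assms swap_arr_P[OF assms] swap_arr_P[OF assms(2,1)] swap_swap[OF assms]
  by (simp add: tot_Comp cong: tot_cong)

theorem Pfn_P_category: "P_category P"
  unfolding P_category_def Let_def
  by (intro conjI ballI P_category_axioms box_functor diag_natural proj_infranatural nat_part_proj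
      assoc_natural_iso swap_natural_iso)
    (simp_all only: P_simps pentagon hexagon symmetry diag_proj)

section \<open>Zero morphisms\<close>

definition zero where "zero X Y = pmor X {} Y"

lemma zero_system: "zero_system P zero"
  unfolding zero_system_def
proof (intro conjI ballI)
  fix X Y assume "X \<in> Obj P" "Y \<in> Obj P"
  then show "zero X Y \<in> hom P X Y" by (auto simp: zero_def pmor_hom)
next
  fix W X Y Z f g
  assume obj: "W \<in> Obj P" "X \<in> Obj P" "Y \<in> Obj P" "Z \<in> Obj P"
    and "f \<in> hom P W X" "g \<in> hom P Y Z"
  then obtain F G where "F \<in> pgraphs W X" "G \<in> pgraphs Y Z" "f = pmor W F X" "g = pmor Y G Z"
    using obj by (auto simp: pmor_hom)
  then show "g \<cdot>\<^bsub>P\<^esub> (zero X Y \<cdot>\<^bsub>P\<^esub> f) = zero W Z"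
    using obj by (simp add: zero_def P_Comp)
qed

text \<open>The standard argument that zero morphisms are unique: composing with the empty partial morphism on
  both sides fixes the first system and yields the second.\<close>

lemma zero_system_unique:
  assumes z: "zero_system P z" and X: "X \<in> Obj K" and Y: "Y \<in> Obj K"
  shows "z X Y = zero X Y"
proof -
  have hom: "z X Y \<in> hom P X Y" "zero X X \<in> hom P X X" "zero Y Y \<in> hom P Y Y"
    using z zero_system X Y unfolding zero_system_def by auto
  obtain G where G: "G \<in> pgraphs X Y" "z X Y = pmor X G Y"
    using hom(1) X Y by (auto simp: pmor_hom)
  have "z X Y = zero Y Y \<cdot>\<^bsub>P\<^esub> (z X Y \<cdot>\<^bsub>P\<^esub> zero X X)"
    using z X Y hom(2,3) unfolding zero_system_def P_simps by metis
  also have "\<dots> = zero X Y"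
    using X Y G by (simp add: zero_def P_Comp)
  finally show ?thesis .
qed

theorem Pfn_prodominical: "prodominical_with P zero"
  unfolding prodominical_with_def
proof (intro conjI ballI Pfn_P_category zero_system)
  fix f X Y assume "f \<in> Arr P" and XY: "X \<in> Obj P" "Y \<in> Obj P"
  then obtain A B G where f: "A \<in> Obj K" "B \<in> Obj K" "G \<in> pgraphs A B" "f = pmor A G B"
    unfolding Arr_Pfn by blast
  have "box_graph A X B Y G {} = {}" by (simp add: box_graph_def)
  then show "box_arr P f (zero X Y) = zero (box_obj P (Dom P f) X) (box_obj P (Cod P f) Y)"
    using f XY by (simp add: zero_def P_box)
qed

definition point where "point d = ({d}, ({d}, restrict id {d}, D))"

lemma point_Obj: "d \<in> D \<Longrightarrow> point d \<in> Obj K"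
  by (auto simp: Obj_K point_def colour_def small_finite)

text \<open>An element of the product of a point coloured \<open>a\<close> and a point coloured \<open>b\<close> would have both colours,
  so the product is empty and the near product of the two identities is zero.\<close>

theorem Pfn_not_dominical:
  assumes a: "a \<in> D" and b: "b \<in> D" and ab: "a \<noteq> b"
  shows "\<not> dominical P"
proof
  assume "dominical P"
  then obtain z where z: "zero_system P z" and prod: "\<And>f g. f \<in> Arr P \<Longrightarrow> g \<in> Arr P \<Longrightarrow>
      box_arr P f g = z (box_obj P (Dom P f) (Dom P g)) (box_obj P (Cod P f) (Cod P g)) \<Longrightarrow>
      f = z (Dom P f) (Cod P f) \<or> g = z (Dom P g) (Cod P g)"
    unfolding dominical_def prodominical_with_def by blast
  define A where "A = point a"
  define B where "B = point b"
  have obj: "A \<in> Obj K" "B \<in> Obj K" using a b point_Obj by (auto simp: A_def B_def)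
  have el: "fst A = {a}" "fst B = {b}" "colour A a = a" "colour B b = b"
    by (auto simp: A_def B_def point_def colour_def)
  have id: "fgraph X (\<lambda>x. x) \<in> pgraphs X X" for X
    by (rule pgraphs_fgraph[OF colour_map_id])
  have "fst (fib_prod A B) = {}"
  proof (rule ccontr)
    assume "fst (fib_prod A B) \<noteq> {}"
    then obtain w where w: "w \<in> fst (fib_prod A B)" by blast
    have "prj0 A B w = a" "prj1 A B w = b" using prj_in(1,2)[OF obj w] el by auto
    then show False using prj_in(3,4)[OF obj w] el ab by simp
  qed
  then have "box_graph A B A B (fgraph A (\<lambda>x. x)) (fgraph B (\<lambda>x. x)) = {}"
    by (simp add: box_graph_def)
  then have "box_arr P (Idn P A) (Idn P B) = z (fib_prod A B) (fib_prod A B)"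
    using obj P_box[OF obj(1,1) obj(2,2) id id] zero_system_unique[OF z]
    by (simp add: tot_def zero_def)
  then have "Idn P A = z A A \<or> Idn P B = z B B"
    using prod[of "Idn P A" "Idn P B"] obj by (simp add: tot_Arr colour_map_id)
  moreover have "Idn P X \<noteq> z X X" if X: "X \<in> Obj K" and ne: "fst X \<noteq> {}" for X
  proof
    assume "Idn P X = z X X"
    then have "pmor X (fgraph X (\<lambda>x. x)) X = pmor X {} X"
      using X zero_system_unique[OF z X X] by (simp add: tot_def zero_def)
    then have "fgraph X (\<lambda>x. x) = {}"
      by (rule pmor_inj[OF X X id])
    then show False using ne by (simp add: fgraph_def)
  qed
  ultimately show False using obj el by auto
qed

end

theorem proposition1p4:
  assumes "grothendieck_universe TYPE('u)"
  shows "\<exists>F :: 'u set_endo.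
    is_functor Set_cat Set_cat F \<and> nontrivial F \<and> bounded_endo F \<and>
    weakly_preserves_pullbacks Set_cat Set_cat F \<and>
    prodominical (Pfn (Coalg Set_cat F)) \<and>
    \<not> dominical (Pfn (Coalg Set_cat F))"
proof -
  have inf: "infinite (UNIV :: 'u set)"
    using assms by (simp add: grothendieck_universe_def)
  then have "\<not> UNIV \<subseteq> {undefined :: 'u}"
    by (meson finite.emptyI finite.insertI finite_subset)
  then obtain a b :: 'u where ab: "a \<noteq> b" by blast
  interpret coloured_sets "{a, b}"
    using assms inf by unfold_locales (simp_all add: small_def finite_lesspoll_infinite)
  have "nontrivial (const_endo {a, b})"
    by (simp add: nontrivial_def const_endo_def)
  then show ?thesis
    using const_functor const_bounded const_weakly_preserves_pullbacks Pfn_prodominical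
      Pfn_not_dominical[of a b] ab
    unfolding prodominical_def by blast
qed

end
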